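(* Let $n\ge 1$, let $\{u_1,\dots,u_n\}\subset H^2$ be orthonormal and let $\{v_1,\dots,v_n\}\subset H^2$ be an orthogonal set of nonzero vectors. Suppose $g=f_1\overline{f_2}$ on $\mathbb{T}$, where $f_1$ and $f_2$ are invertible elements of the Banach algebra $H^\infty$, and let $R_n:H^2\to H^2$ be given by $R_n h=T_g h+\sum_{i=1}^n\langle h,u_i\rangle v_i$. Then the subspace $\ker R_n$ is nearly $S^*$-invariant with defect at most $n$ and defect space $F=\operatorname{span}\{T_{f_1^{-1}}T_{\overline{f_2}^{-1}}(S^*v_i) : i=1,\dots,n\}$.
   Context: $H^2$ is the Hardy space of the unit disc $\mathbb{D}$, identified via boundary values with a closed subspace of $L^2(\mathbb{T})$; $H^\infty$ is the Banach algebra of bounded analytic functions on $\mathbb{D}$, viewed as a subalgebra of $L^\infty(\mathbb{T})$; $P:L^2(\mathbb{T})\to H^2$ is the orthogonal projection; for $g\in L^\infty(\mathbb{T})$ the Toeplitz operator is $T_g f=P(gf)$ for $f\in H^2$. The backward shift is $S^*f(z)=(f(z)-f(0))/z$. A subspace $M\subset H^2$ is nearly $S^*$-invariant with defect $m$ if there is an $m$-dimensional subspace $F$ such that $S^*f\in M+F$ whenever $f\in M$ and $f(0)=0$; $F$ is called the defect space. "Defect at most $n$ and defect space $F$" means that this inclusion holds with the given $F$ and $\dim F\le n$. *)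

theory Defs
  imports "HOL-Analysis.Analysis" "HOL-Library.Function_Algebras" "HOL-Library.Set_Algebras"
begin

text \<open>
  Functions on the disc are total functions that are 0 outside the open unit disc, so that
  equality of elements of the spaces below is equality of HOL functions. The complex vector space
  structure on all of \<^typ>\<open>complex \<Rightarrow> complex\<close> is the pointwise one.
\<close>

definition cfun_scale :: "complex \<Rightarrow> (complex \<Rightarrow> complex) \<Rightarrow> (complex \<Rightarrow> complex)" where
  "cfun_scale c f = (\<lambda>z. c * f z)"

global_interpretation cfun: vector_space cfun_scale
  by standard (auto simp: cfun_scale_def fun_eq_iff algebra_simps)

subsection \<open>The unit circle\<close>

text \<open>Normalized arc length on the unit circle.\<close>
definition circle_measure :: "complex measure" where
  "circle_measure =
     distr (uniform_measure lborel {0..2 * pi}) (restrict_space borel (sphere 0 1)) cis"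

text \<open>Elements of \<open>L\<^sup>2\<close> and \<open>L\<^sup>\<infinity>\<close> of the circle are represented by
  functions; almost everywhere equal functions represent the same element.\<close>
definition L2_circle :: "(complex \<Rightarrow> complex) set" where
  "L2_circle = {\<phi> \<in> borel_measurable circle_measure.
     integrable circle_measure (\<lambda>\<zeta>. (cmod (\<phi> \<zeta>))\<^sup>2)}"

definition L2_inner :: "(complex \<Rightarrow> complex) \<Rightarrow> (complex \<Rightarrow> complex) \<Rightarrow> complex" where
  "L2_inner \<phi> \<psi> = (LINT \<zeta>|circle_measure. \<phi> \<zeta> * cnj (\<psi> \<zeta>))"

definition Linf_circle :: "(complex \<Rightarrow> complex) set" where
  "Linf_circle = {\<phi> \<in> borel_measurable circle_measure.
     \<exists>C. AE \<zeta> in circle_measure. cmod (\<phi> \<zeta>) \<le> C}"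

subsection \<open>Hardy spaces\<close>

definition H2 :: "(complex \<Rightarrow> complex) set" where
  "H2 = {f. f holomorphic_on ball 0 1 \<and> (\<forall>z. z \<notin> ball 0 1 \<longrightarrow> f z = 0) \<and>
     (\<exists>C. \<forall>r\<in>{0..<1::real}. (LINT \<zeta>|circle_measure. (cmod (f (of_real r * \<zeta>)))\<^sup>2) \<le> C)}"

definition Hinf :: "(complex \<Rightarrow> complex) set" where
  "Hinf = {f. f holomorphic_on ball 0 1 \<and> (\<forall>z. z \<notin> ball 0 1 \<longrightarrow> f z = 0) \<and>
     bounded (f ` ball 0 1)}"

text \<open>The inverse of an invertible \<open>f\<close> is \<open>\<lambda>z. inverse (f z)\<close>, which is
  again 0 outside the disc because \<open>inverse 0 = 0\<close>.\<close>
definition Hinf_invertible :: "(complex \<Rightarrow> complex) \<Rightarrow> bool" where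
  "Hinf_invertible f \<longleftrightarrow> f \<in> Hinf \<and> (\<exists>k\<in>Hinf. \<forall>z\<in>ball 0 1. f z * k z = 1)"

text \<open>Radial boundary values. By Fatou's theorem the limit exists at almost every point of the
  circle for \<open>f\<close> in \<^const>\<open>H2\<close>; elsewhere on the circle the value is
  unspecified.\<close>
definition boundary :: "(complex \<Rightarrow> complex) \<Rightarrow> complex \<Rightarrow> complex" where
  "boundary f \<zeta> = Lim (at_left 1) (\<lambda>r::real. f (of_real r * \<zeta>))"

definition H2_inner :: "(complex \<Rightarrow> complex) \<Rightarrow> (complex \<Rightarrow> complex) \<Rightarrow> complex" where
  "H2_inner f h = L2_inner (boundary f) (boundary h)"

subsection \<open>Operators\<close>

text \<open>The orthogonal projection of \<^const>\<open>L2_circle\<close> onto \<^const>\<open>H2\<close>.\<close>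
definition H2_proj :: "(complex \<Rightarrow> complex) \<Rightarrow> (complex \<Rightarrow> complex)" where
  "H2_proj \<phi> = (THE h. h \<in> H2 \<and>
     (\<forall>k\<in>H2. L2_inner (\<lambda>\<zeta>. \<phi> \<zeta> - boundary h \<zeta>) (boundary k) = 0))"

definition Toeplitz :: "(complex \<Rightarrow> complex) \<Rightarrow> (complex \<Rightarrow> complex) \<Rightarrow> (complex \<Rightarrow> complex)" where
  "Toeplitz g f = H2_proj (\<lambda>\<zeta>. g \<zeta> * boundary f \<zeta>)"

text \<open>At the origin the quotient takes its limit value, the derivative.\<close>
definition backward_shift :: "(complex \<Rightarrow> complex) \<Rightarrow> (complex \<Rightarrow> complex)" where
  "backward_shift f = (\<lambda>z. if z = 0 then deriv f 0
     else if z \<in> ball 0 1 then (f z - f 0) / z else 0)"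

definition perturbed_Toeplitz ::
  "(complex \<Rightarrow> complex) \<Rightarrow> nat \<Rightarrow> (nat \<Rightarrow> complex \<Rightarrow> complex) \<Rightarrow> (nat \<Rightarrow> complex \<Rightarrow> complex) \<Rightarrow>
     (complex \<Rightarrow> complex) \<Rightarrow> (complex \<Rightarrow> complex)" where
  "perturbed_Toeplitz g n u v h =
     Toeplitz g h + (\<Sum>i\<in>{1..n}. cfun_scale (H2_inner h (u i)) (v i))"

definition H2_kernel :: "((complex \<Rightarrow> complex) \<Rightarrow> (complex \<Rightarrow> complex)) \<Rightarrow> (complex \<Rightarrow> complex) set" where
  "H2_kernel R = {h \<in> H2. R h = 0}"

subsection \<open>Nearly invariant subspaces\<close>

text \<open>\<open>M\<close> is nearly invariant under the backward shift with defect at most \<open>n\<close> and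
  defect space \<open>F\<close>. Finite dimensionality of \<open>F\<close> is required separately because the
  library dimension of an infinite-dimensional space is 0.\<close>
definition nearly_invariant_defect_le ::
  "(complex \<Rightarrow> complex) set \<Rightarrow> nat \<Rightarrow> (complex \<Rightarrow> complex) set \<Rightarrow> bool" where
  "nearly_invariant_defect_le M n F \<longleftrightarrow>
     cfun.subspace M \<and> M \<subseteq> H2 \<and>
     cfun.subspace F \<and> F \<subseteq> H2 \<and>
     (\<exists>B. finite B \<and> F \<subseteq> cfun.span B) \<and> cfun.dim F \<le> n \<and>
     (\<forall>f\<in>M. f 0 = 0 \<longrightarrow> backward_shift f \<in> M + F)"

end

theory Submission
  imports Defs "HOL-Complex_Analysis.Complex_Analysis" "HOL-Probability.Probability_Measure"
begin

text \<open>
  Write \<open>S\<close> for the backward shift and \<open>T\<close> for Toeplitz operators. Two identities carry the proof.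
  On functions vanishing at the origin \<open>T g\<close> commutes with \<open>S\<close> (\<open>Toeplitz_backward_shift\<close>), because
  for such a function the shift is multiplication by \<open>cnj \<zeta>\<close> on the circle. And \<open>T g\<close> has the
  explicit left inverse \<open>T (1/f1) \<circ> T (1/cnj f2)\<close> (\<open>Toeplitz_left_inverse\<close>): multiplication by
  the conjugate of a bounded analytic function maps the orthogonal complement of \<open>H2\<close> into itself,
  so applying \<open>1/cnj f2\<close> undoes the factor \<open>cnj f2\<close> in spite of the projection in between.

  Now let \<open>h\<close> be in the kernel of the perturbed operator with \<open>h 0 = 0\<close>. Then \<open>T g h\<close> is a linear
  combination of the \<open>v i\<close>, and \<open>S h = T (1/f1) (T (1/cnj f2) (T g (S h))) =
  T (1/f1) (T (1/cnj f2) (S (T g h)))\<close> is the same combination of the vectors spanning the defect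
  space. So the shift of \<open>h\<close> lies in the defect space itself, with zero component in the kernel.

  These identities are verified on the circle, so the bulk of the work is the boundary behaviour of
  \<open>H2\<close>: almost everywhere existence of radial limits (Fatou's theorem), and existence of the
  orthogonal projection. Radial limits come from a maximal inequality. Vitali's covering lemma
  bounds the set where some interval average of a function is large (\<open>hardy_littlewood_weak_type\<close>);
  the Poisson kernel is dominated by a combination of interval averages, so the same
  bound holds for the radial maximal function (\<open>radial_maximal_weak_type\<close>). It is applied to the
  difference of \<open>f\<close> and a dilation \<open>f (\<rho> z)\<close>, which is small in mean square for \<open>\<rho>\<close> near 1,
  while the dilation is continuous up to the circle; hence \<open>f\<close> oscillates arbitrarily little along
  almost every radius (\<open>H2_radial_limit_AE\<close>).

  Everything else is done with Taylor coefficients: \<open>f\<close> is in \<open>H2\<close> iff they are square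
  summable, they are the nonnegatively indexed Fourier coefficients of the boundary function, and the projection of an
  \<open>L2\<close> function is the power series of its nonnegative Fourier coefficients.
\<close>

section \<open>The Hardy-Littlewood maximal inequality on the line\<close>

text \<open>
  Cover the points by intervals with large average. Their radii are bounded because the integral of
  \<open>\<psi>\<close> is finite, so Vitali's lemma selects disjoint ones whose fivefold enlargements still cover,
  and the total length of the disjoint ones is controlled by the integral. The exceptional set is
  replaced by a measurable superset \<open>U\<close>, which spares a proof that it is measurable itself.
\<close>
lemma hardy_littlewood_weak_type:
  fixes \<psi> :: "real \<Rightarrow> ennreal" and l :: real
  assumes [measurable]: "\<psi> \<in> borel_measurable lborel"
    and fin: "(\<integral>\<^sup>+x. \<psi> x \<partial>lborel) < \<infinity>" and l: "l > 0"
  obtains U where "U \<in> sets lborel"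
    and "{x. \<exists>s>0. (\<integral>\<^sup>+y. \<psi> y * indicator (cball x s) y \<partial>lborel) > ennreal (2 * s * l)} \<subseteq> U"
    and "emeasure lborel U \<le> ennreal (5 / l) * (\<integral>\<^sup>+x. \<psi> x \<partial>lborel)"
proof -
  define \<nu> where "\<nu> = density lborel \<psi>"
  define I where "I = enn2real (\<integral>\<^sup>+x. \<psi> x \<partial>lborel)"
  have I: "(\<integral>\<^sup>+x. \<psi> x \<partial>lborel) = ennreal I"
    using fin by (simp add: I_def)
  have I0: "I \<ge> 0" by (simp add: I_def)
  have nu: "emeasure \<nu> A = (\<integral>\<^sup>+y. \<psi> y * indicator A y \<partial>lborel)" if "A \<in> sets borel" for A
    using that by (simp add: \<nu>_def emeasure_density)
  have nu_le: "emeasure \<nu> A \<le> ennreal I" for A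
  proof -
    have "emeasure \<nu> A \<le> emeasure \<nu> (space \<nu>)" by (rule emeasure_space)
    also have "\<dots> = ennreal I" by (simp add: \<nu>_def emeasure_density I)
    finally show ?thesis .
  qed
  define E where "E = {x. \<exists>s>0. (\<integral>\<^sup>+y. \<psi> y * indicator (cball x s) y \<partial>lborel) > ennreal (2 * s * l)}"
  define K where "K = {(x, s). s > 0 \<and> emeasure \<nu> (cball x s) > ennreal (2 * s * l)}"
  have cover: "E \<subseteq> (\<Union>i\<in>K. cball (fst i) (snd i))"
  proof
    fix x assume "x \<in> E"
    then obtain s where "s > 0" "emeasure \<nu> (cball x s) > ennreal (2 * s * l)"
      by (auto simp: E_def nu)
    then have "(x, s) \<in> K" "x \<in> cball (fst (x, s)) (snd (x, s))" by (auto simp: K_def)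
    then show "x \<in> (\<Union>i\<in>K. cball (fst i) (snd i))" by blast
  qed
  have bounded: "0 < snd i \<and> snd i \<le> I / (2 * l)" if iK: "i \<in> K" for i
  proof -
    obtain x s where i: "i = (x, s)" "s > 0" "emeasure \<nu> (cball x s) > ennreal (2 * s * l)"
      using iK by (cases i) (auto simp: K_def)
    then have "ennreal (2 * s * l) < ennreal I" using nu_le by (meson less_le_trans)
    then have "2 * s * l < I" using i l by (simp add: ennreal_less_iff)
    then show ?thesis using i l by (simp add: field_simps)
  qed
  obtain C where C: "countable C" "C \<subseteq> K"
    and disj: "pairwise (\<lambda>i j. disjnt (cball (fst i) (snd i)) (cball (fst j) (snd j))) C"
    and sub: "E \<subseteq> (\<Union>i\<in>C. cball (fst i) (5 * snd i))"
    using Vitali_covering_lemma_cballs[OF cover bounded] by blast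
  define U where "U = (\<Union>i\<in>C. cball (fst i) (5 * snd i))"
  have "emeasure lborel U \<le> (\<integral>\<^sup>+i. emeasure lborel (cball (fst i) (5 * snd i)) \<partial>count_space C)"
  proof -
    have U: "U \<in> sets lborel" unfolding U_def using C by (intro sets.countable_UN'') auto
    have "emeasure lborel U = (\<integral>\<^sup>+x. indicator U x \<partial>lborel)" using U by simp
    also have "\<dots> \<le> (\<integral>\<^sup>+x. \<integral>\<^sup>+i. indicator (cball (fst i) (5 * snd i)) x \<partial>count_space C \<partial>lborel)"
    proof (rule nn_integral_mono)
      fix x
      show "indicator U x \<le> (\<integral>\<^sup>+i. indicator (cball (fst i) (5 * snd i)) x \<partial>count_space C)"
      proof (cases "x \<in> U")
        case True
        then obtain i where "i \<in> C" "x \<in> cball (fst i) (5 * snd i)" by (auto simp: U_def)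
        then show ?thesis
          using nn_integral_ge_point[of i C "\<lambda>i. indicator (cball (fst i) (5 * snd i)) x"] True by simp
      qed simp
    qed
    also have "\<dots> = (\<integral>\<^sup>+i. emeasure lborel (cball (fst i) (5 * snd i)) \<partial>count_space C)"
      using C by (subst nn_integral_count_space_nn_integral) (auto intro!: borel_measurable_indicator)
    finally show ?thesis .
  qed
  also have "\<dots> \<le> (\<integral>\<^sup>+i. ennreal (5 / l) * emeasure \<nu> (cball (fst i) (snd i)) \<partial>count_space C)"
  proof (rule nn_integral_mono)
    fix i assume "i \<in> space (count_space C)"
    then have "i \<in> K" using C by auto
    then obtain x s where i: "i = (x, s)" "s > 0" "emeasure \<nu> (cball x s) > ennreal (2 * s * l)"
      by (cases i) (auto simp: K_def)
    have "emeasure lborel (cball x (5 * s)) = ennreal (10 * s)"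
      using i by (simp add: cball_eq_atLeastAtMost)
    also have "\<dots> = ennreal (5 / l) * ennreal (2 * s * l)"
      using i l by (simp add: ennreal_mult' [symmetric] field_simps)
    also have "\<dots> \<le> ennreal (5 / l) * emeasure \<nu> (cball x s)"
      using i by (intro mult_left_mono) auto
    finally show "emeasure lborel (cball (fst i) (5 * snd i)) \<le> ennreal (5 / l) * emeasure \<nu> (cball (fst i) (snd i))"
      by (simp add: i)
  qed
  also have "\<dots> = ennreal (5 / l) * (\<integral>\<^sup>+i. emeasure \<nu> (cball (fst i) (snd i)) \<partial>count_space C)"
    by (rule nn_integral_cmult) auto
  also have "(\<integral>\<^sup>+i. emeasure \<nu> (cball (fst i) (snd i)) \<partial>count_space C)
      = emeasure \<nu> (\<Union>i\<in>C. cball (fst i) (snd i))"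
    by (rule emeasure_UN_countable[symmetric])
       (use C disj in \<open>auto simp: \<nu>_def disjoint_family_on_def pairwise_def disjnt_def\<close>)
  also have "ennreal (5 / l) * \<dots> \<le> ennreal (5 / l) * ennreal I"
    by (intro mult_left_mono nu_le) auto
  finally have "emeasure lborel U \<le> ennreal (5 / l) * (\<integral>\<^sup>+x. \<psi> x \<partial>lborel)" by (simp add: I)
  moreover have "U \<in> sets lborel" unfolding U_def using C by (intro sets.countable_UN'') auto
  ultimately show ?thesis using that sub unfolding E_def U_def by blast
qed

text \<open>
  The kernel is at most \<open>4 / (4 ^ k \<cdot> \<delta>)\<close> on the interval of radius \<open>2 ^ k \<cdot> \<delta>\<close> and outside the previous one. It
  is therefore dominated by a sum of interval averages with geometrically decaying weights, and
  each average is at most \<open>l\<close>.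
\<close>
lemma bump_kernel_domination:
  fixes \<psi> :: "real \<Rightarrow> ennreal" and l \<delta> x :: real
  assumes [measurable]: "\<psi> \<in> borel_measurable lborel"
    and avg: "\<And>s. s > 0 \<Longrightarrow> (\<integral>\<^sup>+y. \<psi> y * indicator (cball x s) y \<partial>lborel) \<le> ennreal (2 * s * l)"
    and l: "l > 0" and \<delta>: "\<delta> > 0"
  shows "(\<integral>\<^sup>+y. ennreal (\<delta> / (max \<delta> \<bar>y - x\<bar>)\<^sup>2) * \<psi> y \<partial>lborel) \<le> ennreal (16 * l)"
proof -
  define c where "c k = ennreal (4 * (1/4) ^ k / \<delta>)" for k :: nat
  have pt: "ennreal (\<delta> / (max \<delta> \<bar>y - x\<bar>)\<^sup>2) \<le> (\<Sum>k. c k * indicator (cball x (2 ^ k * \<delta>)) y)" for y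
  proof -
    have "\<exists>k. \<bar>y - x\<bar> \<le> 2 ^ k * \<delta>"
      using real_arch_pow[of 2 "\<bar>y - x\<bar> / \<delta>"] \<delta> by (auto simp: field_simps intro: less_imp_le)
    define k where "k = (LEAST k. \<bar>y - x\<bar> \<le> 2 ^ k * \<delta>)"
    have k: "\<bar>y - x\<bar> \<le> 2 ^ k * \<delta>" unfolding k_def by (rule LeastI_ex) fact
    \<comment> \<open>By minimality of \<open>k\<close> the radius is at most twice the distance, or equal to \<open>\<delta>\<close>.\<close>
    have "2 ^ k * \<delta> \<le> 2 * max \<delta> \<bar>y - x\<bar>"
    proof (cases k)
      case (Suc j)
      have "\<not> \<bar>y - x\<bar> \<le> 2 ^ j * \<delta>" using not_less_Least[of j "\<lambda>k. \<bar>y - x\<bar> \<le> 2 ^ k * \<delta>"] Suc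
        unfolding k_def by simp
      then show ?thesis using Suc by simp
    qed (use \<delta> in \<open>auto simp: max_def\<close>)
    then have "(2 ^ k * \<delta>)\<^sup>2 \<le> (2 * max \<delta> \<bar>y - x\<bar>)\<^sup>2" using \<delta> by (intro power_mono) auto
    moreover have "((2::real) ^ k)\<^sup>2 = 4 ^ k" by (simp add: power2_eq_square flip: power_mult_distrib)
    ultimately have "4 ^ k * \<delta>\<^sup>2 \<le> 4 * (max \<delta> \<bar>y - x\<bar>)\<^sup>2"
      by (simp add: power_mult_distrib)
    moreover have "max \<delta> \<bar>y - x\<bar> > 0" using \<delta> by auto
    ultimately have "\<delta> / (max \<delta> \<bar>y - x\<bar>)\<^sup>2 \<le> 4 * (1/4) ^ k / \<delta>"
      using \<delta> by (simp add: field_simps power2_eq_square power_one_over)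
    then have "ennreal (\<delta> / (max \<delta> \<bar>y - x\<bar>)\<^sup>2) \<le> c k * indicator (cball x (2 ^ k * \<delta>)) y"
      using k by (auto simp: c_def dist_real_def intro!: ennreal_leI)
    also have "\<dots> \<le> (\<Sum>k. c k * indicator (cball x (2 ^ k * \<delta>)) y)"
      using sum_le_suminf[of "\<lambda>k. c k * indicator (cball x (2 ^ k * \<delta>)) y" "{k}"]
      by (simp del: sum_mult_indicator indicator_simps)
    finally show ?thesis .
  qed
  have "(\<integral>\<^sup>+y. ennreal (\<delta> / (max \<delta> \<bar>y - x\<bar>)\<^sup>2) * \<psi> y \<partial>lborel)
      \<le> (\<integral>\<^sup>+y. (\<Sum>k. c k * (\<psi> y * indicator (cball x (2 ^ k * \<delta>)) y)) \<partial>lborel)"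
  proof (rule nn_integral_mono)
    fix y
    have "ennreal (\<delta> / (max \<delta> \<bar>y - x\<bar>)\<^sup>2) * \<psi> y \<le> (\<Sum>k. c k * indicator (cball x (2 ^ k * \<delta>)) y) * \<psi> y"
      by (intro mult_right_mono pt) auto
    also have "\<dots> = (\<Sum>k. c k * (\<psi> y * indicator (cball x (2 ^ k * \<delta>)) y))"
      by (simp flip: ennreal_suminf_multc add: mult_ac)
    finally show "ennreal (\<delta> / (max \<delta> \<bar>y - x\<bar>)\<^sup>2) * \<psi> y \<le> (\<Sum>k. c k * (\<psi> y * indicator (cball x (2 ^ k * \<delta>)) y))" .
  qed
  also have "\<dots> = (\<Sum>k. c k * (\<integral>\<^sup>+y. \<psi> y * indicator (cball x (2 ^ k * \<delta>)) y \<partial>lborel))"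
  proof -
    have [measurable]: "(\<lambda>y. \<psi> y * indicator (cball x s) y) \<in> borel_measurable lborel" for s
      by (intro borel_measurable_times_ennreal assms borel_measurable_indicator) auto
    show ?thesis by (subst nn_integral_suminf) (auto simp: nn_integral_cmult)
  qed
  also have "\<dots> \<le> (\<Sum>k. ennreal (8 * l * (1/2) ^ k))"
  proof (rule suminf_le)
    fix k :: nat
    have "c k * (\<integral>\<^sup>+y. \<psi> y * indicator (cball x (2 ^ k * \<delta>)) y \<partial>lborel) \<le> c k * ennreal (2 * (2 ^ k * \<delta>) * l)"
      using \<delta> by (intro mult_left_mono avg) auto
    also have "\<dots> = ennreal (8 * l * (1/2) ^ k)"
    proof -
      have "(4::real) ^ k = 2 ^ k * 2 ^ k" by (simp flip: power_mult_distrib)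
      then have "4 * (1/4) ^ k / \<delta> * (2 * (2 ^ k * \<delta>) * l) = 8 * l * (1/2) ^ k"
        using \<delta> by (simp add: field_simps)
      then show ?thesis unfolding c_def using \<delta> l by (simp flip: ennreal_mult)
    qed
    finally show "c k * (\<integral>\<^sup>+y. \<psi> y * indicator (cball x (2 ^ k * \<delta>)) y \<partial>lborel) \<le> ennreal (8 * l * (1/2) ^ k)" .
  qed auto
  also have "\<dots> = ennreal (16 * l)"
  proof -
    have "(\<lambda>k. 8 * l * (1/2) ^ k) sums (8 * l * (1 / (1 - 1/2)))"
      by (intro sums_mult geometric_sums) auto
    then show ?thesis using l by (intro suminf_ennreal_eq) auto
  qed
  finally show ?thesis .
qed

section \<open>Normalized arc length\<close>

lemma space_circle [simp]: "space circle_measure = sphere 0 1"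
  by (simp add: circle_measure_def space_restrict_space)

lemma sets_circle [measurable_cong]: "sets circle_measure = sets (restrict_space borel (sphere 0 1))"
  by (simp add: circle_measure_def)

lemma measurable_cis_circle: "cis \<in> uniform_measure lborel {0..2 * pi} \<rightarrow>\<^sub>M restrict_space borel (sphere 0 1)"
proof (rule measurable_restrict_space2)
  show "cis \<in> borel_measurable (uniform_measure lborel {0..2 * pi})"
    by (subst measurable_cong_sets[OF sets_uniform_measure refl])
       (auto intro!: borel_measurable_continuous_onI continuous_intros)
qed auto

lemma prob_space_circle: "prob_space circle_measure"
  unfolding circle_measure_def
  by (intro prob_space.prob_space_distr prob_space_uniform_measure measurable_cis_circle) auto

lemma nn_integral_circle:
  assumes "F \<in> borel_measurable circle_measure"
  shows "(\<integral>\<^sup>+\<zeta>. F \<zeta> \<partial>circle_measure) =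
    (\<integral>\<^sup>+t. F (cis t) * indicator {0..2 * pi} t \<partial>lborel) / ennreal (2 * pi)"
proof -
  have F: "F \<in> borel_measurable (restrict_space borel (sphere 0 1))"
    using assms by (simp add: measurable_cong_sets[OF sets_circle refl])
  have [measurable]: "(\<lambda>t. F (cis t)) \<in> borel_measurable (uniform_measure lborel {0..2 * pi})"
    by (rule measurable_compose[OF measurable_cis_circle F])
  then have [measurable]: "(\<lambda>t. F (cis t)) \<in> borel_measurable lborel"
    by (simp add: measurable_cong_sets[OF sets_uniform_measure refl])
  show ?thesis unfolding circle_measure_def
    by (subst nn_integral_distr[OF measurable_cis_circle], use F in simp, subst nn_integral_uniform_measure) auto
qed

lemma measurable_circle_continuous:
  fixes F :: "complex \<Rightarrow> 'b::topological_space"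
  assumes "continuous_on (sphere 0 1) F"
  shows "F \<in> borel_measurable circle_measure"
  using assms by (simp add: measurable_cong_sets[OF sets_circle refl] borel_measurable_continuous_on_restrict)

lemma integral_circle_monomials:
  "(\<integral>\<zeta>. \<zeta> ^ m * cnj (\<zeta> ^ n) \<partial>circle_measure) = (if m = n then 1 else 0)"
proof -
  interpret prob_space circle_measure by (rule prob_space_circle)
  show ?thesis
  proof (cases "m = n")
    case True
    have "(\<integral>\<zeta>. \<zeta> ^ m * cnj (\<zeta> ^ n) \<partial>circle_measure) = (\<integral>\<zeta>. 1 \<partial>circle_measure)"
      by (rule Bochner_Integration.integral_cong)
         (auto simp: True norm_power complex_norm_square[symmetric] simp flip: complex_cnj_power)
    then show ?thesis using True prob_space by simp
  next
    case False
    define k where "k = real m - real n"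
    have k: "k \<noteq> 0" using False by (simp add: k_def)
    define F where "F = (\<lambda>t. cis (k * t) / (\<i> * k))"
    have meas: "(\<lambda>\<zeta>::complex. \<zeta> ^ m * cnj (\<zeta> ^ n)) \<in> borel_measurable (restrict_space borel (sphere 0 1))"
      by (intro borel_measurable_continuous_on_restrict continuous_intros)
    have e: "cis t ^ m * cnj (cis t ^ n) = cis (k * t)" for t
      by (simp add: Complex.DeMoivre cis_cnj cis_mult k_def algebra_simps)
    have "(\<integral>\<zeta>. \<zeta> ^ m * cnj (\<zeta> ^ n) \<partial>circle_measure)
      = (\<integral>t. cis (k * t) \<partial>uniform_measure lborel {0..2 * pi})"
      unfolding circle_measure_def by (subst integral_distr[OF measurable_cis_circle meas]) (simp only: e)
    also have "\<dots> = (\<integral>t. (indicator {0..2*pi} t / (2 * pi)) *\<^sub>R cis (k * t) \<partial>lborel)"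
    proof -
      have "uniform_measure lborel {0..2 * pi} = density lborel (\<lambda>t. ennreal (indicator {0..2*pi} t / (2 * pi)))"
        unfolding uniform_measure_def
        by (rule arg_cong2[where f=density]) (auto simp: fun_eq_iff indicator_def divide_ennreal[symmetric])
      then show ?thesis
        by (simp only:, subst integral_density)
           (auto intro!: borel_measurable_continuous_onI continuous_intros)
    qed
    also have "\<dots> = (1 / (2 * pi)) *\<^sub>R (\<integral>t. indicator {0..2*pi} t *\<^sub>R cis (k * t) \<partial>lborel)"
      by (subst integral_scaleR_right[symmetric]) (auto intro!: Bochner_Integration.integral_cong)
    also have "(\<integral>t. indicator {0..2*pi} t *\<^sub>R cis (k * t) \<partial>lborel) = F (2*pi) - F 0"
    proof (rule has_bochner_integral_integral_eq[OF has_bochner_integral_FTC_Icc])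
      show "(F has_vector_derivative cis (k * t)) (at t within {0..2*pi})" for t
      proof -
        have "((\<lambda>z. exp (\<i> * k * z) / (\<i> * k)) has_field_derivative exp (\<i> * k * of_real t)) (at (of_real t))"
          using k by (auto intro!: derivative_eq_intros)
        from has_vector_derivative_real_field[OF this] show ?thesis
          by (simp add: F_def cis_conv_exp mult.assoc)
      qed
    qed (auto intro!: continuous_intros)
    also have "F (2*pi) = F 0"
    proof -
      have "k * (2 * pi) = 2 * pi * of_int (int m - int n)" by (simp add: k_def mult.commute)
      then have "cis (k * (2 * pi)) = 1" by (simp only:) (rule cis_multiple_2pi, simp)
      then show ?thesis by (simp add: F_def)
    qed
    finally show ?thesis using False by simp
  qed
qed

section \<open>The Poisson integral and the radial maximal function\<close>

text \<open>
  Cauchy's formula for \<open>f w \<cdot> (1 - r^2) / (1 - r w)\<close>, which agrees with \<open>f\<close> at the point \<open>r\<close>, turns the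
  Cauchy kernel into the Poisson kernel. The circle is rotated by \<open>x + \<pi>\<close> so that the parameter
  interval \<open>{0..2 \<pi>}\<close> of the contour becomes the interval centred at \<open>x\<close>; the evaluation point
  is then \<open>-r\<close>.
\<close>
lemma norm_le_poisson_integral:
  fixes f :: "complex \<Rightarrow> complex" and r x :: real
  assumes contf: "continuous_on (cball 0 1) f" and holf: "f holomorphic_on ball 0 1"
    and r: "0 \<le> r" "r < 1"
  shows "ennreal (2 * pi * cmod (f (r * cis x))) \<le>
    (\<integral>\<^sup>+y. ennreal ((1 - r\<^sup>2) / (cmod (cis (y - x) - r))\<^sup>2) *
          (ennreal (cmod (f (cis y))) * indicator {x - pi..x + pi} y) \<partial>lborel)"
proof -
  have r2: "r\<^sup>2 < 1" using r by (simp add: abs_square_less_1)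
  have nz: "1 + r * w \<noteq> 0" if "w \<in> cball 0 1" for w :: complex
  proof
    assume "1 + r * w = 0"
    then have "cmod (r * w) = 1" by (metis add_eq_0_iff norm_minus_cancel norm_one)
    moreover have "r * cmod w \<le> r * 1" using that r by (intro mult_left_mono) auto
    ultimately show False using r by (simp add: norm_mult)
  qed
  \<comment> \<open>The factor next to \<open>f\<close> is 1 at \<open>w = -r\<close> and turns the Cauchy kernel into the Poisson kernel.\<close>
  define G where "G = (\<lambda>w::complex. f (- w * cis x) * (1 - r\<^sup>2) / (1 + r * w))"
  have hol: "G holomorphic_on ball 0 1"
    unfolding G_def
  proof (intro holomorphic_intros holomorphic_on_compose_gen[OF _ holf, unfolded o_def])
    show "(\<lambda>w. - w * cis x) ` ball 0 1 \<subseteq> ball 0 1" by (auto simp: norm_mult)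
  qed (use nz in auto)
  have cont: "continuous_on (cball 0 1) G"
    unfolding G_def
  proof (intro continuous_intros continuous_on_compose2[OF contf])
    show "(\<lambda>w. - w * cis x) ` cball 0 1 \<subseteq> cball 0 1" by (auto simp: norm_mult)
  qed (use nz in auto)
  define h where "h = (\<lambda>t. G (cis t) / (cis t + r) * \<i> * cis t)"
  have nz2: "cis t + r \<noteq> 0" for t
  proof
    assume "cis t + r = 0"
    then have "cmod (complex_of_real r) = 1" by (metis add_eq_0_iff norm_minus_cancel norm_cis)
    then show False using r by simp
  qed
  have "((\<lambda>u. G u / (u - of_real (- r))) has_contour_integral (2 * of_real pi * \<i> * G (of_real (- r)))) (circlepath 0 1)"
    by (rule Cauchy_integral_circlepath[OF cont hol]) (use r in simp)
  then have hI: "(h has_integral (2 * of_real pi * \<i> * G (of_real (- r)))) {0..2 * pi}"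
    unfolding circlepath_def
    by (subst (asm) has_contour_integral_part_circlepath_iff) (auto simp: h_def)
  have Gr: "G (of_real (- r)) = f (r * cis x)"
  proof -
    have "1 - complex_of_real r * complex_of_real r \<noteq> 0"
      using r2 by (simp add: power2_eq_square) (metis of_real_1 of_real_eq_iff of_real_mult less_irrefl)
    then show ?thesis by (simp add: G_def power2_eq_square)
  qed
  have conth: "continuous_on {0..2 * pi} h"
    unfolding h_def
    by (intro continuous_intros continuous_on_compose2[OF cont]) (use nz2 in auto)
  have inth: "integrable lborel (\<lambda>t. indicator {0..2*pi} t *\<^sub>R h t)"
    using borel_integrable_atLeastAtMost'[OF conth] by (simp add: set_integrable_def)
  have eqh: "(\<integral>t. indicator {0..2*pi} t *\<^sub>R h t \<partial>lborel) = 2 * of_real pi * \<i> * f (r * cis x)"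
    using set_borel_integral_eq_integral(2)[OF borel_integrable_atLeastAtMost'[OF conth]] hI Gr
    by (simp add: set_lebesgue_integral_def integral_unique)
  define K where "K = (\<lambda>y. ennreal ((1 - r\<^sup>2) / (cmod (cis (y - x) - r))\<^sup>2) *
          (ennreal (cmod (f (cis y))) * indicator {x - pi..x + pi} y))"
  have normh: "ennreal (norm (indicator {0..2*pi} t *\<^sub>R h t)) = K (x - pi + 1 * t)" for t
  proof -
    have c: "cis (x - pi + t) = - cis t * cis x"
      by (simp add: cis_mult [symmetric] cis_divide[symmetric])
    have "cis (x - pi + t - x) = - cis t" by (simp add: cis_divide[symmetric])
    then have "cmod (cis (x - pi + t - x) - r) = cmod (- (cis t + r))" by simp
    then have d: "cmod (cis (x - pi + t - x) - r) = cmod (cis t + r)" by (simp only: norm_minus_cancel)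
    have "1 + r * cis t = cis t * cnj (cis t + r)"
      by (simp add: algebra_simps cis_cnj cis_mult)
    then have e: "cmod (1 + r * cis t) = cmod (cis t + r)" by (simp only: norm_mult complex_mod_cnj) simp
    have "cmod (h t) = (1 - r\<^sup>2) / (cmod (cis t + r))\<^sup>2 * cmod (f (- cis t * cis x))"
    proof -
      have "cmod (1 - (complex_of_real r)\<^sup>2) = 1 - r\<^sup>2"
        using r2 by (metis abs_of_nonneg diff_ge_0_iff_ge less_imp_le norm_of_real of_real_1 of_real_diff of_real_power)
      then show ?thesis
        by (simp add: h_def G_def norm_mult norm_divide e power2_eq_square)
    qed
    then show ?thesis
      using r2 unfolding K_def by (auto simp: c d[simplified] ennreal_mult'[symmetric] indicator_def)
  qed
  have contcis: "continuous_on UNIV (\<lambda>y. cmod (f (cis y)))"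
    by (intro continuous_intros continuous_on_compose2[OF contf]) auto
  then have [measurable]: "(\<lambda>y. cmod (f (cis y))) \<in> borel_measurable borel"
    by (rule borel_measurable_continuous_onI)
  have [measurable]: "(\<lambda>y. cmod (cis (y - x) - r)) \<in> borel_measurable borel"
    by (intro borel_measurable_continuous_onI continuous_intros)
  have K[measurable]: "K \<in> borel_measurable borel"
    unfolding K_def by measurable
  have "ennreal (2 * pi * cmod (f (r * cis x))) = ennreal (norm (\<integral>t. indicator {0..2*pi} t *\<^sub>R h t \<partial>lborel))"
    by (simp add: eqh norm_mult)
  also have "\<dots> \<le> (\<integral>\<^sup>+t. ennreal (norm (indicator {0..2*pi} t *\<^sub>R h t)) \<partial>lborel)"
    by (rule integral_norm_bound_ennreal[OF inth])
  also have "\<dots> = (\<integral>\<^sup>+t. K (x - pi + 1 * t) \<partial>lborel)" by (simp only: normh)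
  also have "\<dots> = (\<integral>\<^sup>+y. K y \<partial>lborel)"
    using nn_integral_real_affine[OF K, of 1 "x - pi"] by simp
  finally show ?thesis unfolding K_def .
qed

text \<open>
  The point \<open>r\<close> has distance at least \<open>1 - r\<close> from the circle, and replacing it by 1 at most
  doubles the distance to \<open>cis \<tau>\<close>, which leaves the chord length \<open>2 |sin (\<tau> / 2)|\<close>. The factor 6 is
  what the crude estimates \<open>|sin s| \<ge> |s| / 3\<close> and \<open>\<pi> < 4\<close> give.
\<close>
lemma cmod_cis_minus_real_ge:
  assumes r: "0 \<le> r" "r < 1" and \<tau>: "\<bar>\<tau>\<bar> \<le> pi"
  shows "max (1 - r) \<bar>\<tau>\<bar> \<le> 6 * cmod (cis \<tau> - r)"
proof -
  have sin3: "\<bar>s\<bar> / 3 \<le> \<bar>sin s\<bar>" if "\<bar>s\<bar> \<le> 2" for s :: real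
  proof -
    have "\<bar>sin s - (\<Sum>m<3. sin_coeff m * s ^ m)\<bar> \<le> inverse (fact 3) * \<bar>s\<bar> ^ 3"
      by (rule Maclaurin_sin_bound)
    then have "\<bar>sin s - s\<bar> \<le> \<bar>s\<bar> ^ 3 / 6"
    proof -
      have "(\<Sum>m<3. sin_coeff m * s ^ m) = s" by (simp add: numeral_3_eq_3 sin_coeff_def)
      moreover have "inverse (fact 3 :: real) = 1 / 6" by (simp add: fact_numeral)
      ultimately show ?thesis using \<open>\<bar>sin s - (\<Sum>m<3. sin_coeff m * s ^ m)\<bar> \<le> inverse (fact 3) * \<bar>s\<bar> ^ 3\<close> by (simp only:)
    qed
    moreover have "\<bar>s\<bar> ^ 3 \<le> 4 * \<bar>s\<bar>"
    proof -
      have "\<bar>s\<bar>\<^sup>2 \<le> 2\<^sup>2" using that by (intro power_mono) auto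
      then have "\<bar>s\<bar>\<^sup>2 * \<bar>s\<bar> \<le> 4 * \<bar>s\<bar>" by (intro mult_right_mono) auto
      then show ?thesis by (simp add: power3_eq_cube power2_eq_square)
    qed
    ultimately show ?thesis by linarith
  qed
  have "\<bar>\<tau> / 2\<bar> \<le> 2" using \<tau> pi_less_4 by simp
  then have "\<bar>\<tau>\<bar> / 3 \<le> cmod (cis \<tau> - 1)"
    using sin3[of "\<tau> / 2"] dist_exp_i_1[of \<tau>] by (simp add: cis_conv_exp)
  moreover have "cmod (cis \<tau> - 1) \<le> cmod (cis \<tau> - r) + cmod (complex_of_real r - 1)"
    by (rule norm_triangle_le[of "cis \<tau> - r" "of_real r - 1", simplified]) simp
  moreover have "cmod (complex_of_real r - 1) = 1 - r"
    using r by (metis abs_minus_commute abs_of_pos diff_gt_0_iff_gt norm_of_real of_real_1 of_real_diff)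
  moreover have "1 - r \<le> cmod (cis \<tau> - r)"
    using norm_triangle_ineq2[of "cis \<tau>" "of_real r"] r by simp
  ultimately show ?thesis by linarith
qed

text \<open>
  Intervals of length \<open>2 \<pi>\<close> centred in \<open>{0..2 \<pi>}\<close> stay within three periods; cutting a periodic
  function off there makes it integrable on the line.
\<close>
lemma nn_integral_three_periods:
  fixes F :: "real \<Rightarrow> ennreal"
  assumes [measurable]: "F \<in> borel_measurable borel" and per: "\<And>t. F (t + 2 * pi) = F t"
  shows "(\<integral>\<^sup>+y. F y * indicator {-(2 * pi)..4 * pi} y \<partial>lborel) \<le> 3 * (\<integral>\<^sup>+y. F y * indicator {0..2 * pi} y \<partial>lborel)"
proof -
  define J where "J = (\<lambda>y. F y * indicator {0..2 * pi} y)"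
  have [measurable]: "J \<in> borel_measurable borel" unfolding J_def by measurable
  have per': "F (t - 2 * pi) = F t" for t using per[of "t - 2 * pi"] by simp
  have sh: "(\<integral>\<^sup>+y. J (c + y) \<partial>lborel) = (\<integral>\<^sup>+y. J y \<partial>lborel)" for c
    using nn_integral_real_affine[of J 1 c] by simp
  have "(\<integral>\<^sup>+y. F y * indicator {-(2 * pi)..4 * pi} y \<partial>lborel)
      \<le> (\<integral>\<^sup>+y. J (2 * pi + y) + (J y + J (- (2 * pi) + y)) \<partial>lborel)"
  proof (rule nn_integral_mono)
    fix y
    have c: "F (2 * pi + y) = F y" "F (- (2 * pi) + y) = F y"
      using per[of y] per'[of y] by (simp_all add: algebra_simps)
    consider "y < -(2*pi) \<or> y > 4 * pi" | "y \<in> {-(2*pi)..0}" | "y \<in> {0..2*pi}" | "y \<in> {2*pi..4*pi}" by force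
    then show "F y * indicator {-(2 * pi)..4 * pi} y \<le> J (2 * pi + y) + (J y + J (- (2 * pi) + y))"
    proof cases
      case 1 then show ?thesis by auto
    next
      case 2
      then have "J (2 * pi + y) = F y" by (simp add: J_def c per')
      moreover have "F y * indicator {-(2 * pi)..4 * pi} y = F y" using 2 pi_ge_zero by (auto simp: indicator_def)
      ultimately show ?thesis by simp
    next
      case 3
      then have "J y = F y" by (simp add: J_def)
      moreover have "F y * indicator {-(2 * pi)..4 * pi} y = F y" using 3 pi_ge_zero by (auto simp: indicator_def)
      ultimately show ?thesis by (simp add: add_increasing)
    next
      case 4
      then have "J (- (2 * pi) + y) = F y" by (simp add: J_def c per')
      moreover have "F y * indicator {-(2 * pi)..4 * pi} y = F y" using 4 pi_ge_zero by (auto simp: indicator_def)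
      ultimately show ?thesis by (simp add: add_increasing)
    qed
  qed
  also have "\<dots> = 3 * (\<integral>\<^sup>+y. J y \<partial>lborel)"
  proof -
    have "a + (a + a) = 3 * a" for a :: ennreal
    proof -
      have "(3::ennreal) = 1 + (1 + 1)" by simp
      then show ?thesis by (metis distrib_right mult_1_left)
    qed
    then show ?thesis using sh[of "- (2 * pi)"] sh[of "2 * pi"] by (simp add: nn_integral_add)
  qed
  finally show ?thesis by (simp add: J_def)
qed

lemma dilation_continuous_measurable:
  assumes "f holomorphic_on ball 0 1" "0 \<le> r" "r < 1"
  shows "continuous_on (sphere 0 1) (\<lambda>\<zeta>. f (of_real r * \<zeta>))"
    "(\<lambda>\<zeta>. f (of_real r * \<zeta>)) \<in> borel_measurable circle_measure"
proof -
  show "continuous_on (sphere 0 1) (\<lambda>\<zeta>. f (of_real r * \<zeta>))"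
    by (intro continuous_on_compose2[OF holomorphic_on_imp_continuous_on[OF assms(1)]] continuous_intros)
       (use assms in \<open>auto simp: norm_mult\<close>)
  then show "(\<lambda>\<zeta>. f (of_real r * \<zeta>)) \<in> borel_measurable circle_measure"
    by (rule measurable_circle_continuous)
qed

text \<open>
  If \<open>x\<close> is outside the exceptional set of the Hardy-Littlewood inequality, all averages about
  \<open>x\<close> are at most \<open>l\<close>, and so is, up to a constant, the Poisson integral at every point
  of the radius. The constant is \<open>1152 = 72 \<cdot> 16\<close>: the Poisson kernel is at most 72 times
  the bump kernel. The factor 15 in the measure of \<open>U\<close> is 5 from Vitali times three periods.
\<close>
lemma radial_maximal_closed_disc:
  fixes f :: "complex \<Rightarrow> complex"
  assumes contf: "continuous_on (cball 0 1) f" and holf: "f holomorphic_on ball 0 1"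
    and B: "(\<integral>\<^sup>+\<zeta>. cmod (f \<zeta>) \<partial>circle_measure) \<le> ennreal B" "B \<ge> 0" and l: "l > 0"
  obtains U where "U \<in> sets lborel" "emeasure lborel U \<le> ennreal (2 * pi * (15 / l * B))"
    and "\<And>x r. x \<in> {0..2 * pi} \<Longrightarrow> 0 \<le> r \<Longrightarrow> r < 1 \<Longrightarrow> cmod (f (of_real r * cis x)) > 1152 * l \<Longrightarrow> x \<in> U"
proof -
  define F where "F = (\<lambda>y. ennreal (cmod (f (cis y))))"
  have "continuous_on UNIV (\<lambda>y. cmod (f (cis y)))"
    by (intro continuous_intros continuous_on_compose2[OF contf]) auto
  then have [measurable]: "(\<lambda>y. cmod (f (cis y))) \<in> borel_measurable borel"
    by (rule borel_measurable_continuous_onI)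
  have [measurable]: "F \<in> borel_measurable borel" unfolding F_def by measurable
  have per: "F (t + 2 * pi) = F t" for t by (simp add: F_def cis_mult[symmetric])
  define \<psi> where "\<psi> = (\<lambda>y. F y * indicator {-(2 * pi)..4 * pi} y)"
  have [measurable]: "\<psi> \<in> borel_measurable lborel" unfolding \<psi>_def by measurable
  have "(\<lambda>\<zeta>. ennreal (cmod (f \<zeta>))) \<in> borel_measurable circle_measure"
    by (intro measurable_compose[OF measurable_circle_continuous measurable_ennreal] continuous_intros
          continuous_on_subset[OF contf]) auto
  from nn_integral_circle[OF this]
  have "(\<integral>\<^sup>+t. F t * indicator {0..2 * pi} t \<partial>lborel) / ennreal (2 * pi) \<le> ennreal B"
    using B(1) by (simp add: F_def)
  then have "ennreal (2 * pi) * ((\<integral>\<^sup>+t. F t * indicator {0..2 * pi} t \<partial>lborel) / ennreal (2 * pi)) \<le> ennreal (2 * pi) * ennreal B"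
    by (rule mult_left_mono) simp
  then have one: "(\<integral>\<^sup>+t. F t * indicator {0..2 * pi} t \<partial>lborel) \<le> ennreal (B * (2 * pi))"
  proof -
    have "ennreal (2 * pi) \<noteq> 0" "ennreal (2 * pi) \<noteq> top" by (simp_all add: ennreal_eq_0_iff not_le)
    then have "ennreal (2 * pi) * (x / ennreal (2 * pi)) = x" for x
      by (simp only: ennreal_times_divide mult.commute[of "ennreal (2 * pi)"] mult_divide_eq_ennreal not_False_eq_True)
    moreover have "ennreal (2 * pi) * ennreal B = ennreal (B * (2 * pi))"
      using B(2) by (simp add: mult.commute[of B] ennreal_mult)
    ultimately show ?thesis using \<open>_ \<le> ennreal (2 * pi) * ennreal B\<close> by (simp only:)
  qed
  then have psi: "(\<integral>\<^sup>+y. \<psi> y \<partial>lborel) \<le> ennreal (3 * (B * (2 * pi)))"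
  proof -
    have "(\<integral>\<^sup>+y. \<psi> y \<partial>lborel) \<le> 3 * (\<integral>\<^sup>+t. F t * indicator {0..2 * pi} t \<partial>lborel)"
      unfolding \<psi>_def using per by (intro nn_integral_three_periods) measurable
    also have "\<dots> \<le> ennreal 3 * ennreal (B * (2 * pi))" using one by (simp add: mult_left_mono)
    also have "\<dots> = ennreal (3 * (B * (2 * pi)))" using B(2) by (intro ennreal_mult[symmetric]) auto
    finally show ?thesis .
  qed
  then have fin: "(\<integral>\<^sup>+y. \<psi> y \<partial>lborel) < \<infinity>"
    by (rule le_less_trans) simp
  obtain U where U: "U \<in> sets lborel"
    "{x. \<exists>s>0. (\<integral>\<^sup>+y. \<psi> y * indicator (cball x s) y \<partial>lborel) > ennreal (2 * s * l)} \<subseteq> U"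
    "emeasure lborel U \<le> ennreal (5 / l) * (\<integral>\<^sup>+x. \<psi> x \<partial>lborel)"
    by (rule hardy_littlewood_weak_type[OF \<open>\<psi> \<in> _\<close> fin l])
  show ?thesis
  proof
    show "U \<in> sets lborel" by fact
    have "emeasure lborel U \<le> ennreal (5 / l) * ennreal (3 * (B * (2 * pi)))"
      using U(3) psi by (meson mult_left_mono order_trans zero_le)
    also have "\<dots> = ennreal (2 * pi * (15 / l * B))"
      using l B(2) by (simp flip: ennreal_mult add: field_simps)
    finally show "emeasure lborel U \<le> ennreal (2 * pi * (15 / l * B))" .
  next
    fix x r :: real
    assume x: "x \<in> {0..2 * pi}" and r: "0 \<le> r" "r < 1" and big: "cmod (f (of_real r * cis x)) > 1152 * l"
    show "x \<in> U"
    proof (rule ccontr)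
      assume "x \<notin> U"
      then have avg: "(\<integral>\<^sup>+y. \<psi> y * indicator (cball x s) y \<partial>lborel) \<le> ennreal (2 * s * l)" if "s > 0" for s
        using U(2) that by (auto simp: not_less[symmetric])
      have "ennreal (2 * pi * cmod (f (r * cis x))) \<le>
        (\<integral>\<^sup>+y. ennreal ((1 - r\<^sup>2) / (cmod (cis (y - x) - r))\<^sup>2) *
          (F y * indicator {x - pi..x + pi} y) \<partial>lborel)"
        unfolding F_def by (rule norm_le_poisson_integral[OF contf holf r])
      also have "\<dots> \<le> (\<integral>\<^sup>+y. ennreal 72 * (ennreal ((1 - r) / (max (1 - r) \<bar>y - x\<bar>)\<^sup>2) * \<psi> y) \<partial>lborel)"
      proof (rule nn_integral_mono)
        fix y
        show "ennreal ((1 - r\<^sup>2) / (cmod (cis (y - x) - r))\<^sup>2) * (F y * indicator {x - pi..x + pi} y)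
          \<le> ennreal 72 * (ennreal ((1 - r) / (max (1 - r) \<bar>y - x\<bar>)\<^sup>2) * \<psi> y)"
        proof (cases "y \<in> {x - pi..x + pi}")
          case True
          then have y: "\<bar>y - x\<bar> \<le> pi" "y \<in> {-(2 * pi)..4 * pi}"
            using x pi_gt_zero by (auto simp: abs_le_iff)
          define m where "m = max (1 - r) \<bar>y - x\<bar>"
          have m: "m > 0" "m \<le> 6 * cmod (cis (y - x) - r)"
            unfolding m_def using r cmod_cis_minus_real_ge[OF r y(1)] by auto
          have "(1 - r\<^sup>2) / (cmod (cis (y - x) - r))\<^sup>2 \<le> (1 - r\<^sup>2) / (m / 6)\<^sup>2"
            using m r by (intro divide_left_mono power_mono) (auto simp: abs_square_le_1 zero_less_mult_iff)
          also have "\<dots> \<le> (2 * (1 - r)) / (m / 6)\<^sup>2"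
          proof (rule divide_right_mono)
            have "(1 - r) * (1 + r) \<le> (1 - r) * 2" using r by (intro mult_left_mono) auto
            then show "1 - r\<^sup>2 \<le> 2 * (1 - r)" by (simp add: power2_eq_square algebra_simps)
          qed simp
          also have "\<dots> = 72 * ((1 - r) / m\<^sup>2)" using m by (simp add: power2_eq_square)
          finally have "ennreal ((1 - r\<^sup>2) / (cmod (cis (y - x) - r))\<^sup>2) \<le> ennreal 72 * ennreal ((1 - r) / m\<^sup>2)"
            using r m by (simp flip: ennreal_mult del: ennreal_numeral)
          then show ?thesis using y True unfolding m_def[symmetric]
            by (simp add: \<psi>_def mult.assoc[symmetric] mult_right_mono del: ennreal_numeral)
        qed simp
      qed
      also have "\<dots> = ennreal 72 * (\<integral>\<^sup>+y. ennreal ((1 - r) / (max (1 - r) \<bar>y - x\<bar>)\<^sup>2) * \<psi> y \<partial>lborel)"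
        by (rule nn_integral_cmult) measurable
      also have "\<dots> \<le> ennreal 72 * ennreal (16 * l)"
        by (intro mult_left_mono bump_kernel_domination avg) (use l r in auto)
      also have "\<dots> = ennreal (1152 * l)" using l by (simp flip: ennreal_mult del: ennreal_numeral)
      finally have "2 * pi * cmod (f (r * cis x)) \<le> 1152 * l" using l by simp
      moreover have "1 * cmod (f (r * cis x)) \<le> 2 * pi * cmod (f (r * cis x))"
        using pi_gt3 by (intro mult_right_mono) auto
      ultimately show False using big by simp
    qed
  qed
qed

text \<open>
  The set is relatively open, being a union over \<open>r\<close> of open conditions on \<open>\<zeta>\<close>.
\<close>
lemma radial_superlevel_measurable:
  assumes holf: "f holomorphic_on ball 0 1" and R: "R \<le> 1"
  shows "{\<zeta>\<in>sphere 0 1. \<exists>r\<in>{0..<R}. cmod (f (of_real r * \<zeta>)) > l} \<in> sets circle_measure"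
proof -
  have "openin (top_of_set (sphere 0 1)) {\<zeta>\<in>sphere 0 1. \<exists>r\<in>{0..<R}. cmod (f (of_real r * \<zeta>)) > l}"
  proof -
    have "openin (top_of_set (sphere 0 1)) (sphere 0 1 \<inter> (\<lambda>\<zeta>. cmod (f (of_real r * \<zeta>))) -` {l<..})"
      if "r \<in> {0..<R}" for r
      using that R
      by (intro continuous_openin_preimage_gen continuous_intros dilation_continuous_measurable(1)[OF holf]) auto
    then have "openin (top_of_set (sphere 0 1)) (\<Union>r\<in>{0..<R}. sphere 0 1 \<inter> (\<lambda>\<zeta>. cmod (f (of_real r * \<zeta>))) -` {l<..})"
      by blast
    also have "(\<Union>r\<in>{0..<R}. sphere 0 1 \<inter> (\<lambda>\<zeta>. cmod (f (of_real r * \<zeta>))) -` {l<..})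
       = {\<zeta>\<in>sphere 0 1. \<exists>r\<in>{0..<R}. cmod (f (of_real r * \<zeta>)) > l}" by auto
    finally show ?thesis .
  qed
  then obtain T where "open T" "{\<zeta>\<in>sphere 0 1. \<exists>r\<in>{0..<R}. cmod (f (of_real r * \<zeta>)) > l} = sphere 0 1 \<inter> T"
    by (auto simp: openin_open)
  then show ?thesis by (auto simp: sets_circle sets_restrict_space)
qed

text \<open>
  The case of a function continuous on the closed disc applies to the dilations \<open>f (R z)\<close>; as \<open>R\<close>
  tends to 1 the superlevel sets increase to the one of \<open>f\<close>. The constant is
  \<open>17280 = 15 \<cdot> 1152\<close>.
\<close>
lemma radial_maximal_weak_type:
  assumes holf: "f holomorphic_on ball 0 1" and l: "l > 0" and B0: "B \<ge> 0"
    and B: "\<And>r. r \<in> {0..<1::real} \<Longrightarrow> (\<integral>\<^sup>+\<zeta>. cmod (f (of_real r * \<zeta>)) \<partial>circle_measure) \<le> ennreal B"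
  shows "emeasure circle_measure {\<zeta>\<in>sphere 0 1. \<exists>r\<in>{0..<1}. cmod (f (of_real r * \<zeta>)) > l}
    \<le> ennreal (17280 * B / l)"
proof -
  define A where "A R = {\<zeta>\<in>sphere 0 1. \<exists>r\<in>{0..<R}. cmod (f (of_real r * \<zeta>)) > l}" for R :: real
  have A[measurable]: "A R \<in> sets circle_measure" if "R \<le> 1" for R
    unfolding A_def using radial_superlevel_measurable[OF holf that] .
  have step: "emeasure circle_measure (A R) \<le> ennreal (17280 * B / l)" if R: "0 < R" "R < 1" for R
  proof -
    define g where "g = (\<lambda>z. f (of_real R * z))"
    have sub: "(\<lambda>z. complex_of_real R * z) ` cball 0 1 \<subseteq> ball 0 1"
    proof (rule image_subsetI)
      fix z :: complex assume "z \<in> cball 0 1"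
      then have "R * cmod z \<le> R * 1" using R by (intro mult_left_mono) auto
      then have "R * cmod z < 1" using R by linarith
      then show "complex_of_real R * z \<in> ball 0 1" using R by (simp add: norm_mult)
    qed
    have contg: "continuous_on (cball 0 1) g"
      unfolding g_def
      by (intro continuous_on_compose2[OF holomorphic_on_imp_continuous_on[OF holf]] continuous_intros sub)
    have holg: "g holomorphic_on ball 0 1"
      unfolding g_def
      by (intro holomorphic_on_compose_gen[OF _ holf, unfolded o_def] holomorphic_intros)
         (use order_trans[OF image_mono[OF ball_subset_cball] sub] in auto)
    have "(\<integral>\<^sup>+\<zeta>. cmod (g \<zeta>) \<partial>circle_measure) \<le> ennreal B" unfolding g_def using B R by auto
    then obtain U where U: "U \<in> sets lborel" "emeasure lborel U \<le> ennreal (2 * pi * (15 / (l / 1152) * B))"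
      "\<And>x r. x \<in> {0..2 * pi} \<Longrightarrow> 0 \<le> r \<Longrightarrow> r < 1 \<Longrightarrow> cmod (g (of_real r * cis x)) > 1152 * (l / 1152) \<Longrightarrow> x \<in> U"
      using radial_maximal_closed_disc[OF contg holg _ B0, of "l / 1152"] l by auto
    have "emeasure circle_measure (A R) = (\<integral>\<^sup>+t. indicator (A R) (cis t) * indicator {0..2 * pi} t \<partial>lborel) / ennreal (2 * pi)"
      using A[of R] R by (subst nn_integral_circle[symmetric]) auto
    also have "\<dots> \<le> (\<integral>\<^sup>+t. indicator U t \<partial>lborel) / ennreal (2 * pi)"
    proof (intro divide_right_mono_ennreal nn_integral_mono)
      fix t
      have "t \<in> U" if t: "cis t \<in> A R" "t \<in> {0..2 * pi}"
      proof -
        obtain r where r: "r \<in> {0..<R}" "cmod (f (of_real r * cis t)) > l" using t by (auto simp: A_def)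
        have "of_real R * (of_real (r / R) * cis t) = of_real r * cis t" using R by simp
        then have "cmod (g (of_real (r / R) * cis t)) > 1152 * (l / 1152)" using r by (simp add: g_def)
        moreover have "0 \<le> r / R" "r / R < 1" using r R by auto
        ultimately show ?thesis using U(3) t by blast
      qed
      then show "indicator (A R) (cis t) * indicator {0..2 * pi} t \<le> (indicator U t :: ennreal)"
        by (auto simp: indicator_def)
    qed
    also have "\<dots> = emeasure lborel U / ennreal (2 * pi)" using U by simp
    also have "\<dots> \<le> ennreal (2 * pi * (15 / (l / 1152) * B)) / ennreal (2 * pi)"
      by (intro divide_right_mono_ennreal U)
    also have "\<dots> = ennreal (17280 * B / l)"
      using l B0 by (subst divide_ennreal) (auto simp: field_simps)
    finally show ?thesis .
  qed
  define R where "R n = 1 - 1 / real (n + 2)" for n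
  have R: "0 < R n" "R n < 1" for n by (auto simp: R_def)
  have Rmono: "R m \<le> R n" if "m \<le> n" for m n using that by (auto simp: R_def intro!: divide_left_mono)
  have "(\<Union>n. A (R n)) = A 1"
  proof
    show "(\<Union>n. A (R n)) \<subseteq> A 1" using R by (fastforce simp: A_def intro: less_trans)
    show "A 1 \<subseteq> (\<Union>n. A (R n))"
    proof
      fix \<zeta> assume "\<zeta> \<in> A 1"
      then obtain r where r: "\<zeta> \<in> sphere 0 1" "0 \<le> r" "r < 1" "cmod (f (of_real r * \<zeta>)) > l" by (auto simp: A_def)
      obtain n where "inverse (real (Suc n)) < 1 - r" using reals_Archimedean[of "1 - r"] r by auto
      moreover have "1 / real (n + 2) \<le> inverse (real (Suc n))" by (simp add: divide_simps)
      ultimately have "r < R n" by (simp add: R_def)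
      then have "\<zeta> \<in> A (R n)" using r by (auto simp: A_def)
      then show "\<zeta> \<in> (\<Union>n. A (R n))" by blast
    qed
  qed
  moreover have "(SUP n. emeasure circle_measure (A (R n))) = emeasure circle_measure (\<Union>n. A (R n))"
  proof (rule SUP_emeasure_incseq)
    show "range (\<lambda>n. A (R n)) \<subseteq> sets circle_measure" using A[OF less_imp_le[OF R(2)]] by blast
    show "incseq (\<lambda>n. A (R n))"
      unfolding incseq_def A_def using Rmono by (fastforce intro: less_le_trans)
  qed
  ultimately have "emeasure circle_measure (A 1) \<le> ennreal (17280 * B / l)"
    using step R by (metis (mono_tags, lifting) SUP_least)
  then show ?thesis by (simp add: A_def)
qed

section \<open>Square integrable functions on the circle\<close>

interpretation circle: prob_space circle_measure by (rule prob_space_circle)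

lemma integrable_circle_continuous:
  fixes F :: "complex \<Rightarrow> 'b::{banach, second_countable_topology}"
  assumes "continuous_on (sphere 0 1) F"
  shows "integrable circle_measure F"
proof -
  have "bounded (F ` sphere 0 1)"
    using assms by (intro compact_imp_bounded compact_continuous_image) auto
  then obtain B where "\<forall>\<zeta>\<in>sphere 0 1. norm (F \<zeta>) \<le> B" by (auto simp: bounded_iff)
  then show ?thesis
    by (intro circle.integrable_const_bound[where B=B] AE_I2 measurable_circle_continuous assms) auto
qed

lemma continuous_L2: "continuous_on (sphere 0 1) \<phi> \<Longrightarrow> \<phi> \<in> L2_circle"
  unfolding L2_circle_def
  by (auto intro!: measurable_circle_continuous integrable_circle_continuous continuous_intros)

lemma L2_measurable [measurable_dest]: "\<phi> \<in> L2_circle \<Longrightarrow> \<phi> \<in> borel_measurable circle_measure"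
  by (simp add: L2_circle_def)

lemma L2_integrable_square: "\<phi> \<in> L2_circle \<Longrightarrow> integrable circle_measure (\<lambda>\<zeta>. (cmod (\<phi> \<zeta>))\<^sup>2)"
  by (simp add: L2_circle_def)

lemma L2_product_integrable:
  assumes "\<phi> \<in> L2_circle" "\<psi> \<in> L2_circle"
  shows "integrable circle_measure (\<lambda>\<zeta>. \<phi> \<zeta> * cnj (\<psi> \<zeta>))"
proof (rule Bochner_Integration.integrable_bound)
  show "integrable circle_measure (\<lambda>\<zeta>. (cmod (\<phi> \<zeta>))\<^sup>2 + (cmod (\<psi> \<zeta>))\<^sup>2)"
    using assms by (intro Bochner_Integration.integrable_add L2_integrable_square)
  note [measurable] = assms[THEN L2_measurable]
  show "(\<lambda>\<zeta>. \<phi> \<zeta> * cnj (\<psi> \<zeta>)) \<in> borel_measurable circle_measure"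
    by (intro borel_measurable_times assms[THEN L2_measurable]
         measurable_compose[OF L2_measurable[OF assms(2)]] borel_measurable_continuous_onI continuous_intros)
  show "AE \<zeta> in circle_measure. norm (\<phi> \<zeta> * cnj (\<psi> \<zeta>)) \<le> norm ((cmod (\<phi> \<zeta>))\<^sup>2 + (cmod (\<psi> \<zeta>))\<^sup>2)"
  proof (rule AE_I2)
    fix \<zeta>
    show "norm (\<phi> \<zeta> * cnj (\<psi> \<zeta>)) \<le> norm ((cmod (\<phi> \<zeta>))\<^sup>2 + (cmod (\<psi> \<zeta>))\<^sup>2)"
    proof -
      have "0 \<le> cmod (\<phi> \<zeta>) * cmod (\<psi> \<zeta>)" by simp
      then have "cmod (\<phi> \<zeta>) * cmod (\<psi> \<zeta>) \<le> (cmod (\<phi> \<zeta>))\<^sup>2 + (cmod (\<psi> \<zeta>))\<^sup>2"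
        using sum_squares_bound[of "cmod (\<phi> \<zeta>)" "cmod (\<psi> \<zeta>)"] by linarith
      then show ?thesis by (simp add: norm_mult)
    qed
  qed
qed

lemma L2_mult_bounded:
  assumes "\<phi> \<in> L2_circle" "b \<in> Linf_circle"
  shows "(\<lambda>\<zeta>. b \<zeta> * \<phi> \<zeta>) \<in> L2_circle"
proof -
  obtain C where C: "AE \<zeta> in circle_measure. cmod (b \<zeta>) \<le> C" and [measurable]: "b \<in> borel_measurable circle_measure"
    using assms(2) by (auto simp: Linf_circle_def)
  note [measurable] = assms(1)[THEN L2_measurable]
  have "integrable circle_measure (\<lambda>\<zeta>. (cmod (b \<zeta> * \<phi> \<zeta>))\<^sup>2)"
  proof (rule Bochner_Integration.integrable_bound)
    show "integrable circle_measure (\<lambda>\<zeta>. C\<^sup>2 * (cmod (\<phi> \<zeta>))\<^sup>2)"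
      using L2_integrable_square[OF assms(1)] by simp
    show "AE \<zeta> in circle_measure. norm ((cmod (b \<zeta> * \<phi> \<zeta>))\<^sup>2) \<le> norm (C\<^sup>2 * (cmod (\<phi> \<zeta>))\<^sup>2)"
      using C by eventually_elim (auto simp: norm_mult power_mult_distrib intro!: mult_right_mono power_mono)
  qed measurable
  then show ?thesis by (auto simp: L2_circle_def)
qed

lemma L2_scale: "\<phi> \<in> L2_circle \<Longrightarrow> (\<lambda>\<zeta>. c * \<phi> \<zeta>) \<in> L2_circle"
  by (rule L2_mult_bounded) (auto simp: Linf_circle_def)

lemma L2_add:
  assumes "\<phi> \<in> L2_circle" "\<psi> \<in> L2_circle"
  shows "(\<lambda>\<zeta>. \<phi> \<zeta> + \<psi> \<zeta>) \<in> L2_circle"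
proof -
  note [measurable] = assms[THEN L2_measurable]
  have "integrable circle_measure (\<lambda>\<zeta>. (cmod (\<phi> \<zeta> + \<psi> \<zeta>))\<^sup>2)"
  proof (rule Bochner_Integration.integrable_bound)
    show "integrable circle_measure (\<lambda>\<zeta>. 2 * (cmod (\<phi> \<zeta>))\<^sup>2 + 2 * (cmod (\<psi> \<zeta>))\<^sup>2)"
      using assms[THEN L2_integrable_square] by simp
    show "AE \<zeta> in circle_measure. norm ((cmod (\<phi> \<zeta> + \<psi> \<zeta>))\<^sup>2) \<le> norm (2 * (cmod (\<phi> \<zeta>))\<^sup>2 + 2 * (cmod (\<psi> \<zeta>))\<^sup>2)"
    proof (rule AE_I2)
      fix \<zeta>
      have "(cmod (\<phi> \<zeta> + \<psi> \<zeta>))\<^sup>2 \<le> (cmod (\<phi> \<zeta>) + cmod (\<psi> \<zeta>))\<^sup>2"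
        by (intro power_mono norm_triangle_ineq) auto
      also have "\<dots> \<le> 2 * (cmod (\<phi> \<zeta>))\<^sup>2 + 2 * (cmod (\<psi> \<zeta>))\<^sup>2"
        using sum_squares_bound[of "cmod (\<phi> \<zeta>)" "cmod (\<psi> \<zeta>)"] by (simp add: power2_sum)
      finally show "norm ((cmod (\<phi> \<zeta> + \<psi> \<zeta>))\<^sup>2) \<le> norm (2 * (cmod (\<phi> \<zeta>))\<^sup>2 + 2 * (cmod (\<psi> \<zeta>))\<^sup>2)"
        by simp
    qed
  qed measurable
  then show ?thesis by (auto simp: L2_circle_def)
qed

lemma L2_diff:
  assumes "\<phi> \<in> L2_circle" "\<psi> \<in> L2_circle"
  shows "(\<lambda>\<zeta>. \<phi> \<zeta> - \<psi> \<zeta>) \<in> L2_circle"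
  using L2_add[OF assms(1) L2_scale[OF assms(2), of "-1"]] by simp

lemma L2_cong_AE:
  assumes "\<phi> \<in> L2_circle" "\<psi> \<in> borel_measurable circle_measure" "AE \<zeta> in circle_measure. \<phi> \<zeta> = \<psi> \<zeta>"
  shows "\<psi> \<in> L2_circle"
proof -
  note [measurable] = assms(2) assms(1)[THEN L2_measurable]
  have "integrable circle_measure (\<lambda>\<zeta>. (cmod (\<phi> \<zeta>))\<^sup>2) \<longleftrightarrow> integrable circle_measure (\<lambda>\<zeta>. (cmod (\<psi> \<zeta>))\<^sup>2)"
    by (rule integrable_cong_AE) (use assms(3) in auto)
  then show ?thesis using assms by (auto simp: L2_circle_def)
qed

lemma L2_inner_add_left:
  "\<lbrakk>\<phi> \<in> L2_circle; \<psi> \<in> L2_circle; \<eta> \<in> L2_circle\<rbrakk> \<Longrightarrow>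
    L2_inner (\<lambda>\<zeta>. \<phi> \<zeta> + \<psi> \<zeta>) \<eta> = L2_inner \<phi> \<eta> + L2_inner \<psi> \<eta>"
  by (simp add: L2_inner_def distrib_right L2_product_integrable)

lemma L2_inner_diff_left:
  "\<lbrakk>\<phi> \<in> L2_circle; \<psi> \<in> L2_circle; \<eta> \<in> L2_circle\<rbrakk> \<Longrightarrow>
    L2_inner (\<lambda>\<zeta>. \<phi> \<zeta> - \<psi> \<zeta>) \<eta> = L2_inner \<phi> \<eta> - L2_inner \<psi> \<eta>"
  by (simp add: L2_inner_def left_diff_distrib L2_product_integrable)

lemma L2_inner_diff_right:
  "\<lbrakk>\<phi> \<in> L2_circle; \<psi> \<in> L2_circle; \<eta> \<in> L2_circle\<rbrakk> \<Longrightarrow>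
    L2_inner \<phi> (\<lambda>\<zeta>. \<psi> \<zeta> - \<eta> \<zeta>) = L2_inner \<phi> \<psi> - L2_inner \<phi> \<eta>"
  by (simp add: L2_inner_def right_diff_distrib L2_product_integrable)

lemma L2_inner_scale_left: "L2_inner (\<lambda>\<zeta>. c * \<phi> \<zeta>) \<eta> = c * L2_inner \<phi> \<eta>"
  by (simp add: L2_inner_def mult.assoc)

lemma L2_inner_commute: "L2_inner \<psi> \<phi> = cnj (L2_inner \<phi> \<psi>)"
proof -
  have "(\<integral>\<zeta>. \<psi> \<zeta> * cnj (\<phi> \<zeta>) \<partial>circle_measure) = (\<integral>\<zeta>. cnj (\<phi> \<zeta> * cnj (\<psi> \<zeta>)) \<partial>circle_measure)"
    by (simp add: mult.commute)
  also have "\<dots> = cnj (\<integral>\<zeta>. \<phi> \<zeta> * cnj (\<psi> \<zeta>) \<partial>circle_measure)" by (rule Bochner_Integration.integral_cnj)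
  finally show ?thesis unfolding L2_inner_def .
qed

lemma L2_inner_self: "L2_inner \<phi> \<phi> = of_real (LINT \<zeta>|circle_measure. (cmod (\<phi> \<zeta>))\<^sup>2)"
  unfolding L2_inner_def complex_norm_square[symmetric] by (rule integral_complex_of_real)

text \<open>
  Only the products have to agree, so that a factor can be moved from one argument to the other.
\<close>
lemma L2_inner_cong_AE:
  assumes "AE \<zeta> in circle_measure. \<phi> \<zeta> * cnj (\<psi> \<zeta>) = \<phi>' \<zeta> * cnj (\<psi>' \<zeta>)"
    and "\<phi> \<in> L2_circle" "\<psi> \<in> L2_circle" "\<phi>' \<in> L2_circle" "\<psi>' \<in> L2_circle"
  shows "L2_inner \<phi> \<psi> = L2_inner \<phi>' \<psi>'"
  unfolding L2_inner_def
  by (rule integral_cong_AE) (use assms L2_product_integrable in auto)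

lemma L2_Cauchy_Schwarz:
  assumes "\<phi> \<in> L2_circle" "\<psi> \<in> L2_circle"
  shows "(cmod (L2_inner \<phi> \<psi>))\<^sup>2 \<le>
    (LINT \<zeta>|circle_measure. (cmod (\<phi> \<zeta>))\<^sup>2) * (LINT \<zeta>|circle_measure. (cmod (\<psi> \<zeta>))\<^sup>2)"
proof -
  note [measurable] = assms[THEN L2_measurable]
  have sq: "(\<integral>\<^sup>+\<zeta>. ennreal (cmod (\<eta> \<zeta>)) ^ 2 \<partial>circle_measure) = ennreal (LINT \<zeta>|circle_measure. (cmod (\<eta> \<zeta>))\<^sup>2)"
    if "\<eta> \<in> L2_circle" for \<eta>
    using nn_integral_eq_integral[OF L2_integrable_square[OF that]] by (simp add: ennreal_power)
  have "ennreal (cmod (L2_inner \<phi> \<psi>)) \<le> (\<integral>\<^sup>+\<zeta>. ennreal (norm (\<phi> \<zeta> * cnj (\<psi> \<zeta>))) \<partial>circle_measure)"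
    unfolding L2_inner_def by (rule integral_norm_bound_ennreal) (rule L2_product_integrable[OF assms])
  also have "\<dots> = (\<integral>\<^sup>+\<zeta>. ennreal (cmod (\<phi> \<zeta>)) * ennreal (cmod (\<psi> \<zeta>)) \<partial>circle_measure)"
    by (simp add: norm_mult ennreal_mult)
  finally have "ennreal (cmod (L2_inner \<phi> \<psi>)) ^ 2 \<le> \<dots> ^ 2" by (rule power_mono) simp
  also have "\<dots> \<le> (\<integral>\<^sup>+\<zeta>. ennreal (cmod (\<phi> \<zeta>)) ^ 2 \<partial>circle_measure) * (\<integral>\<^sup>+\<zeta>. ennreal (cmod (\<psi> \<zeta>)) ^ 2 \<partial>circle_measure)"
    by (rule Cauchy_Schwarz_nn_integral) measurable
  also have "\<dots> = ennreal ((LINT \<zeta>|circle_measure. (cmod (\<phi> \<zeta>))\<^sup>2) * (LINT \<zeta>|circle_measure. (cmod (\<psi> \<zeta>))\<^sup>2))"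
    by (simp only: sq assms) (simp add: ennreal_mult)
  finally show ?thesis by (simp add: ennreal_power ennreal_le_iff)
qed

section \<open>Taylor coefficients and mean squares\<close>

definition has_powser :: "(nat \<Rightarrow> complex) \<Rightarrow> (complex \<Rightarrow> complex) \<Rightarrow> bool" where
  "has_powser a f \<longleftrightarrow> (\<forall>z\<in>ball 0 1. (\<lambda>n. a n * z ^ n) sums f z)"

lemma has_powser_exists: "f holomorphic_on ball 0 1 \<Longrightarrow> \<exists>a. has_powser a f"
  using holomorphic_power_series[of f 0 1] unfolding has_powser_def
  by (intro exI[of _ "\<lambda>n. (deriv ^^ n) f 0 / fact n"]) auto

lemma has_powser_holomorphic: "has_powser a f \<Longrightarrow> f holomorphic_on ball 0 1"
  unfolding has_powser_def by (rule power_series_holomorphic[where a=a]) simp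

lemma has_powser_abs_summable:
  assumes "has_powser a f" "0 \<le> r" "r < 1"
  shows "summable (\<lambda>n. cmod (a n) * r ^ n)"
proof -
  define s where "s = (1 + r) / 2"
  have s: "r < s" "s < 1" "0 \<le> s" using assms by (auto simp: s_def)
  then have "summable (\<lambda>n. a n * of_real s ^ n)"
    using assms(1) unfolding has_powser_def by (auto intro!: sums_summable)
  then have "summable (\<lambda>n. norm (a n * of_real r ^ n))"
    by (rule powser_insidea) (use s assms in auto)
  then show ?thesis using assms(2) by (simp add: norm_mult norm_power)
qed

text \<open>
  The Taylor series of \<open>f\<close> converges absolutely and uniformly on the circle of radius \<open>r\<close>, hence may be
  integrated term by term against \<open>\<psi>\<close>. Parseval's identity, uniqueness of coefficients and
  the orthogonality relations for boundary functions are all special cases or limits of this.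
\<close>
lemma L2_inner_dilation_sums:
  assumes ps: "has_powser a f" and r: "0 \<le> r" "r < 1" and \<psi>: "integrable circle_measure \<psi>"
  shows "(\<lambda>n. cnj (a n) * of_real r ^ n * L2_inner \<psi> (\<lambda>\<zeta>. \<zeta> ^ n)) sums L2_inner \<psi> (\<lambda>\<zeta>. f (of_real r * \<zeta>))"
proof -
  note [measurable] = borel_measurable_integrable[OF \<psi>]
  define F where "F n \<zeta> = \<psi> \<zeta> * cnj (a n * (of_real r * \<zeta>) ^ n)" for n \<zeta>
  have norm_F: "norm (F n \<zeta>) = cmod (a n) * r ^ n * norm (\<psi> \<zeta>)" if "\<zeta> \<in> sphere 0 1" for n \<zeta>
    using that r by (simp add: F_def norm_mult norm_power power_mult_distrib)
  have summ: "summable (\<lambda>n. cmod (a n) * r ^ n)" by (rule has_powser_abs_summable[OF ps r])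
  have meas: "F n \<in> borel_measurable circle_measure" for n
    unfolding F_def by (intro borel_measurable_times borel_measurable_integrable[OF \<psi>] measurable_circle_continuous continuous_intros)
  have int: "integrable circle_measure (F n)" for n
  proof (rule Bochner_Integration.integrable_bound)
    show "integrable circle_measure (\<lambda>\<zeta>. cmod (a n) * r ^ n * norm (\<psi> \<zeta>))" using \<psi> by simp
  qed (use meas norm_F r in \<open>auto intro!: AE_I2\<close>)
  have "(\<lambda>n. integral\<^sup>L circle_measure (F n)) sums (\<integral>\<zeta>. (\<Sum>n. F n \<zeta>) \<partial>circle_measure)"
  proof (rule sums_integral[OF int])
    show "AE \<zeta> in circle_measure. summable (\<lambda>n. norm (F n \<zeta>))"
      by (rule AE_I2) (use norm_F summ in \<open>auto intro: summable_mult2\<close>)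
    have "(\<lambda>n. \<integral>\<zeta>. norm (F n \<zeta>) \<partial>circle_measure) = (\<lambda>n. cmod (a n) * r ^ n * (\<integral>\<zeta>. norm (\<psi> \<zeta>) \<partial>circle_measure))"
    proof
      fix n
      have "(\<integral>\<zeta>. norm (F n \<zeta>) \<partial>circle_measure) = (\<integral>\<zeta>. cmod (a n) * r ^ n * norm (\<psi> \<zeta>) \<partial>circle_measure)"
        by (rule Bochner_Integration.integral_cong) (auto simp: norm_F)
      then show "(\<integral>\<zeta>. norm (F n \<zeta>) \<partial>circle_measure) = cmod (a n) * r ^ n * (\<integral>\<zeta>. norm (\<psi> \<zeta>) \<partial>circle_measure)" by simp
    qed
    then show "summable (\<lambda>n. \<integral>\<zeta>. norm (F n \<zeta>) \<partial>circle_measure)" using summ by (simp add: summable_mult2)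
  qed
  also have "(\<lambda>n. integral\<^sup>L circle_measure (F n)) = (\<lambda>n. cnj (a n) * of_real r ^ n * L2_inner \<psi> (\<lambda>\<zeta>. \<zeta> ^ n))"
  proof
    fix n
    have "F n = (\<lambda>\<zeta>. (cnj (a n) * of_real r ^ n) * (\<psi> \<zeta> * cnj (\<zeta> ^ n)))"
      by (simp add: F_def fun_eq_iff power_mult_distrib mult_ac)
    then show "integral\<^sup>L circle_measure (F n) = cnj (a n) * of_real r ^ n * L2_inner \<psi> (\<lambda>\<zeta>. \<zeta> ^ n)"
      by (simp add: L2_inner_def)
  qed
  also have "(\<integral>\<zeta>. (\<Sum>n. F n \<zeta>) \<partial>circle_measure) = L2_inner \<psi> (\<lambda>\<zeta>. f (of_real r * \<zeta>))"
    unfolding L2_inner_def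
  proof (rule Bochner_Integration.integral_cong)
    fix \<zeta> :: complex assume "\<zeta> \<in> space circle_measure"
    then have "of_real r * \<zeta> \<in> ball 0 1" using r by (simp add: norm_mult)
    then have "(\<lambda>n. a n * (of_real r * \<zeta>) ^ n) sums f (of_real r * \<zeta>)" using ps by (auto simp: has_powser_def)
    then have "(\<lambda>n. F n \<zeta>) sums (\<psi> \<zeta> * cnj (f (of_real r * \<zeta>)))"
      unfolding F_def by (intro sums_mult) (simp add: sums_cnj del: complex_cnj_mult complex_cnj_power)
    then show "(\<Sum>n. F n \<zeta>) = \<psi> \<zeta> * cnj (f (of_real r * \<zeta>))" by (simp add: sums_iff)
  qed simp
  finally show ?thesis .
qed

lemma L2_inner_monomials: "L2_inner (\<lambda>\<zeta>. \<zeta> ^ m) (\<lambda>\<zeta>. \<zeta> ^ n) = (if m = n then 1 else 0)"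
  unfolding L2_inner_def by (rule integral_circle_monomials)

lemma monomial_integrable: "integrable circle_measure (\<lambda>\<zeta>. \<zeta> ^ n :: complex)"
  by (intro integrable_circle_continuous continuous_intros)

lemma L2_inner_dilation_monomial:
  assumes "has_powser a f" "0 \<le> r" "r < 1"
  shows "L2_inner (\<lambda>\<zeta>. \<zeta> ^ n) (\<lambda>\<zeta>. f (of_real r * \<zeta>)) = cnj (a n) * of_real r ^ n"
proof -
  have "(\<lambda>k. cnj (a k) * of_real r ^ k * (if n = k then 1 else 0)) sums L2_inner (\<lambda>\<zeta>. \<zeta> ^ n) (\<lambda>\<zeta>. f (of_real r * \<zeta>))"
    using L2_inner_dilation_sums[OF assms monomial_integrable[of n]] by (simp only: L2_inner_monomials)
  moreover have "(\<lambda>k. cnj (a k) * of_real r ^ k * (if n = k then 1 else 0)) = (\<lambda>k. if k = n then cnj (a k) * of_real r ^ k else 0)"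
    by (auto simp: fun_eq_iff)
  ultimately show ?thesis using sums_single[of n "\<lambda>k. cnj (a k) * of_real r ^ k"] by (simp add: sums_iff)
qed

lemma dilation_L2:
  assumes "f holomorphic_on ball 0 1" "0 \<le> r" "r < 1"
  shows "(\<lambda>\<zeta>. f (of_real r * \<zeta>)) \<in> L2_circle"
  by (intro continuous_L2 dilation_continuous_measurable assms)

lemma parseval_dilation:
  assumes ps: "has_powser a f" and r: "0 \<le> r" "r < 1"
  shows "(\<lambda>n. (cmod (a n))\<^sup>2 * (r ^ n)\<^sup>2) sums (LINT \<zeta>|circle_measure. (cmod (f (of_real r * \<zeta>)))\<^sup>2)"
proof -
  let ?f = "\<lambda>\<zeta>. f (of_real r * \<zeta>)"
  have "integrable circle_measure ?f"
    by (intro integrable_circle_continuous dilation_continuous_measurable has_powser_holomorphic[OF ps] r)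
  from L2_inner_dilation_sums[OF ps r this]
  have "(\<lambda>n. cnj (a n) * of_real r ^ n * cnj (cnj (a n) * of_real r ^ n)) sums L2_inner ?f ?f"
    unfolding L2_inner_commute[of ?f "\<lambda>\<zeta>. \<zeta> ^ _"] L2_inner_dilation_monomial[OF ps r] .
  moreover have "cnj (a n) * of_real r ^ n * cnj (cnj (a n) * of_real r ^ n) = of_real ((cmod (a n))\<^sup>2 * (r ^ n)\<^sup>2)" for n
  proof -
    have "cnj (a n) * of_real r ^ n * cnj (cnj (a n) * of_real r ^ n) = (a n * cnj (a n)) * of_real ((r ^ n)\<^sup>2)"
      by (simp add: power2_eq_square)
    then show ?thesis by (simp only: of_real_mult complex_norm_square)
  qed
  ultimately show ?thesis unfolding L2_inner_self by (simp only: sums_of_real_iff)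
qed

text \<open>
  By Parseval the partial sums of \<open>|a n|^2 r ^ (2 n)\<close> are bounded independently of \<open>r\<close>; let \<open>r\<close>
  tend to 1.
\<close>
lemma H2_powser:
  assumes "f \<in> H2"
  obtains a where "has_powser a f" "summable (\<lambda>n. (cmod (a n))\<^sup>2)"
proof -
  obtain C where C: "\<forall>r\<in>{0..<1::real}. (LINT \<zeta>|circle_measure. (cmod (f (of_real r * \<zeta>)))\<^sup>2) \<le> C"
    and hol: "f holomorphic_on ball 0 1" using assms by (auto simp: H2_def)
  obtain a where a: "has_powser a f" using has_powser_exists[OF hol] by blast
  have "(\<Sum>n<N. (cmod (a n))\<^sup>2) \<le> C" for N
  proof (rule tendsto_upperbound)
    have "((\<lambda>r. \<Sum>n<N. (cmod (a n))\<^sup>2 * (r ^ n)\<^sup>2) \<longlongrightarrow> (\<Sum>n<N. (cmod (a n))\<^sup>2 * (1 ^ n)\<^sup>2)) (at_left (1::real))"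
      by (intro tendsto_intros)
    then show "((\<lambda>r. \<Sum>n<N. (cmod (a n))\<^sup>2 * (r ^ n)\<^sup>2) \<longlongrightarrow> (\<Sum>n<N. (cmod (a n))\<^sup>2)) (at_left (1::real))"
      by simp
    have "eventually (\<lambda>r. r \<in> {0<..<1}) (at_left (1::real))" by (rule eventually_at_leftI[of 0]) auto
    then show "eventually (\<lambda>r. (\<Sum>n<N. (cmod (a n))\<^sup>2 * (r ^ n)\<^sup>2) \<le> C) (at_left (1::real))"
    proof eventually_elim
      case (elim r)
      then have "(\<lambda>n. (cmod (a n))\<^sup>2 * (r ^ n)\<^sup>2) sums (LINT \<zeta>|circle_measure. (cmod (f (of_real r * \<zeta>)))\<^sup>2)"
        by (intro parseval_dilation a) auto
      then have "(\<Sum>n<N. (cmod (a n))\<^sup>2 * (r ^ n)\<^sup>2) \<le> (LINT \<zeta>|circle_measure. (cmod (f (of_real r * \<zeta>)))\<^sup>2)"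
        using sum_le_suminf[of "\<lambda>n. (cmod (a n))\<^sup>2 * (r ^ n)\<^sup>2" "{..<N}"] by (simp add: sums_iff)
      also have "\<dots> \<le> C" using elim C by auto
      finally show ?case .
    qed
  qed simp
  then have "(\<Sum>k\<le>n. (cmod (a k))\<^sup>2) \<le> C" for n using lessThan_Suc_atMost by metis
  then have "summable (\<lambda>n. (cmod (a n))\<^sup>2)" by (intro bounded_imp_summable[of _ C]) auto
  then show ?thesis by (rule that[OF a])
qed

lemma dilation_square_le:
  assumes ps: "has_powser a f" and summ: "summable (\<lambda>n. (cmod (a n))\<^sup>2)" and r: "0 \<le> r" "r < 1"
  shows "(LINT \<zeta>|circle_measure. (cmod (f (of_real r * \<zeta>)))\<^sup>2) \<le> (\<Sum>n. (cmod (a n))\<^sup>2)"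
proof -
  have "(cmod (a n))\<^sup>2 * (r ^ n)\<^sup>2 \<le> (cmod (a n))\<^sup>2" for n
    using r by (intro mult_left_le) (auto intro!: power_le_one)
  then show ?thesis by (rule sums_le[OF _ parseval_dilation[OF ps r] summable_sums[OF summ]])
qed

lemma H2I_powser:
  assumes "has_powser a f" "summable (\<lambda>n. (cmod (a n))\<^sup>2)" "\<And>z. z \<notin> ball 0 1 \<Longrightarrow> f z = 0"
  shows "f \<in> H2"
proof -
  have "\<forall>r\<in>{0..<1::real}. (LINT \<zeta>|circle_measure. (cmod (f (of_real r * \<zeta>)))\<^sup>2) \<le> (\<Sum>n. (cmod (a n))\<^sup>2)"
    using dilation_square_le[OF assms(1,2)] by auto
  then show ?thesis unfolding H2_def using has_powser_holomorphic[OF assms(1)] assms(3) by blast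
qed

section \<open>Radial limits\<close>

text \<open>
  A concrete sequence of radii increasing to 1, used where a limit over all radii has to be replaced by
  countably many conditions.
\<close>
definition rad :: "nat \<Rightarrow> real" where "rad k = 1 - inverse (real (Suc k))"

lemma rad_bounds: "0 \<le> rad k" "rad k < 1" "rad k \<in> {0..<1}"
  by (auto simp: rad_def field_simps)

lemma filterlim_rad: "filterlim rad (at_left 1) sequentially"
  unfolding filterlim_at
proof
  show "\<forall>\<^sub>F k in sequentially. rad k \<in> {..<1} \<and> rad k \<noteq> 1"
    using rad_bounds(2) by (intro always_eventually) (auto simp: less_le)
  show "rad \<longlonglongrightarrow> 1"
    unfolding rad_def using LIMSEQ_inverse_real_of_nat_add_minus[of 1] by simp
qed

lemma eventually_unit_interval_at_left_1: "eventually (\<lambda>r. r \<in> {0..<1}) (at_left (1::real))"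
  by (rule eventually_at_leftI[of 0]) auto

text \<open>
  The Cauchy criterion along an arbitrary filter: \<open>f\<close> converges if it is eventually within any
  distance of some constant.
\<close>
lemma tendsto_exists_of_approx:
  fixes f :: "'a \<Rightarrow> 'b::complete_space"
  assumes F: "F \<noteq> bot" and approx: "\<And>e. e > 0 \<Longrightarrow> \<exists>c. eventually (\<lambda>x. dist (f x) c < e) F"
  shows "\<exists>l. (f \<longlongrightarrow> l) F"
proof -
  have "\<exists>c. eventually (\<lambda>x. dist (f x) c < inverse (real (Suc m))) F" for m
    by (rule approx) simp
  then obtain c where c: "\<And>m. eventually (\<lambda>x. dist (f x) (c m) < inverse (real (Suc m))) F" by metis
  have cc: "dist (c m) (c n) < inverse (real (Suc m)) + inverse (real (Suc n))" for m n
  proof -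
    have "eventually (\<lambda>x. dist (f x) (c m) < inverse (real (Suc m)) \<and> dist (f x) (c n) < inverse (real (Suc n))) F"
      by (intro eventually_conj c)
    then obtain x where "dist (f x) (c m) < inverse (real (Suc m))" "dist (f x) (c n) < inverse (real (Suc n))"
      using eventually_happens' F by fast
    then show ?thesis using dist_triangle3[of "c m" "c n" "f x"] by linarith
  qed
  have "Cauchy c"
  proof (rule metric_CauchyI)
    fix e :: real assume "e > 0"
    then obtain N where N: "inverse (real (Suc N)) < e / 2" using reals_Archimedean[of "e / 2"] by auto
    have le: "inverse (real (Suc m)) \<le> inverse (real (Suc N))" if "m \<ge> N" for m using that by (simp add: field_simps)
    then have "dist (c m) (c n) < e" if "m \<ge> N" "n \<ge> N" for m n using cc[of m n] le[OF that(1)] le[OF that(2)] N by linarith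
    then show "\<exists>M. \<forall>m\<ge>M. \<forall>n\<ge>M. dist (c m) (c n) < e" by blast
  qed
  then obtain l where l: "c \<longlonglongrightarrow> l" using Cauchy_convergent convergent_def by blast
  have "(f \<longlongrightarrow> l) F"
  proof (rule tendstoI)
    fix e :: real assume e: "e > 0"
    have "eventually (\<lambda>m. dist (c m) l < e / 2) sequentially" using l e by (intro tendstoD) auto
    moreover have "eventually (\<lambda>m. inverse (real (Suc m)) < e / 2) sequentially"
      using LIMSEQ_inverse_real_of_nat e by (intro order_tendstoD(2)[of _ 0]) auto
    ultimately have "eventually (\<lambda>m. dist (c m) l < e / 2 \<and> inverse (real (Suc m)) < e / 2) sequentially"
      by (rule eventually_conj)
    then obtain m where m: "dist (c m) l < e / 2" "inverse (real (Suc m)) < e / 2"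
      using eventually_happens' sequentially_bot by fast
    show "eventually (\<lambda>x. dist (f x) l < e) F"
      using c[of m]
    proof eventually_elim
      case (elim x)
      then show ?case using dist_triangle[of "f x" l "c m"] m by linarith
    qed
  qed
  then show ?thesis by blast
qed

lemma oscillation_set_measurable:
  assumes hol: "f holomorphic_on ball 0 1" and \<rho>: "0 \<le> \<rho>"
  shows "{\<zeta>\<in>sphere 0 1. \<forall>r\<in>{\<rho>..<1}. \<forall>s\<in>{\<rho>..<1}. dist (f (of_real r * \<zeta>)) (f (of_real s * \<zeta>)) \<le> e} \<in> sets circle_measure"
    (is "?Q \<in> _")
proof -
  have cl: "closed {\<zeta>\<in>sphere 0 1. dist (f (of_real r * \<zeta>)) (f (of_real s * \<zeta>)) \<le> e}"
    if "r \<in> {\<rho>..<1}" "s \<in> {\<rho>..<1}" for r s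
  proof -
    have "continuous_on (sphere 0 1) (\<lambda>\<zeta>. dist (f (of_real r * \<zeta>)) (f (of_real s * \<zeta>)))"
      using that \<rho> by (intro continuous_intros dilation_continuous_measurable(1)[OF hol]) auto
    then have "closed (sphere 0 1 \<inter> (\<lambda>\<zeta>. dist (f (of_real r * \<zeta>)) (f (of_real s * \<zeta>))) -` {..e})"
      by (intro continuous_closed_preimage) auto
    moreover have "sphere 0 1 \<inter> (\<lambda>\<zeta>. dist (f (of_real r * \<zeta>)) (f (of_real s * \<zeta>))) -` {..e} =
       {\<zeta>\<in>sphere 0 1. dist (f (of_real r * \<zeta>)) (f (of_real s * \<zeta>)) \<le> e}" by auto
    ultimately show ?thesis by simp
  qed
  define Z where "Z = (\<Inter>r\<in>{\<rho>..<1}. \<Inter>s\<in>{\<rho>..<1}. {\<zeta>\<in>sphere 0 1. dist (f (of_real r * \<zeta>)) (f (of_real s * \<zeta>)) \<le> e})"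
  have "closed Z" unfolding Z_def using cl by (intro closed_INT ballI) auto
  moreover have "?Q = sphere 0 1 \<inter> Z" by (auto simp: Z_def)
  ultimately show ?thesis by (auto simp: sets_circle sets_restrict_space)
qed

text \<open>
  The radial limit exists exactly where the oscillation near 1 is small, a countable combination of
  closed conditions; on that set the boundary function is a sequential limit, and off it \<open>Lim\<close>
  takes one fixed default value.
\<close>
lemma boundary_measurable:
  assumes hol: "f holomorphic_on ball 0 1"
  shows "boundary f \<in> borel_measurable circle_measure"
proof -
  define Q where "Q k m = {\<zeta>\<in>sphere 0 1. \<forall>r\<in>{rad k..<1}. \<forall>s\<in>{rad k..<1}.
    dist (f (of_real r * \<zeta>)) (f (of_real s * \<zeta>)) \<le> inverse (real (Suc m))}" for k m
  have Q: "Q k m \<in> sets circle_measure" for k m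
    unfolding Q_def by (intro oscillation_set_measurable hol rad_bounds)
  define G where "G = (\<Inter>m. \<Union>k. Q k m)"
  have G: "G \<in> sets circle_measure" unfolding G_def using Q by blast
  have G_iff: "\<zeta> \<in> G \<longleftrightarrow> (\<exists>l. ((\<lambda>r. f (of_real r * \<zeta>)) \<longlongrightarrow> l) (at_left 1))" if \<zeta>: "\<zeta> \<in> sphere 0 1" for \<zeta>
  proof
    assume "\<zeta> \<in> G"
    show "\<exists>l. ((\<lambda>r. f (of_real r * \<zeta>)) \<longlongrightarrow> l) (at_left 1)"
    proof (rule tendsto_exists_of_approx)
      fix e :: real assume "e > 0"
      then obtain m where m: "inverse (real (Suc m)) < e" using reals_Archimedean by blast
      obtain k where k: "\<zeta> \<in> Q k m" using \<open>\<zeta> \<in> G\<close> by (auto simp: G_def)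
      have "eventually (\<lambda>r. r \<in> {rad k..<1}) (at_left (1::real))"
        by (rule eventually_at_leftI[of "rad k"]) (use rad_bounds in auto)
      then have "eventually (\<lambda>r. dist (f (of_real r * \<zeta>)) (f (of_real (rad k) * \<zeta>)) < e) (at_left 1)"
      proof eventually_elim
        case (elim r)
        then have "dist (f (of_real r * \<zeta>)) (f (of_real (rad k) * \<zeta>)) \<le> inverse (real (Suc m))"
          using k rad_bounds(2)[of k] by (auto simp: Q_def)
        then show ?case using m by simp
      qed
      then show "\<exists>c. eventually (\<lambda>r. dist (f (of_real r * \<zeta>)) c < e) (at_left 1)" by blast
    qed simp
  next
    assume "\<exists>l. ((\<lambda>r. f (of_real r * \<zeta>)) \<longlongrightarrow> l) (at_left 1)"
    then obtain l where l: "((\<lambda>r. f (of_real r * \<zeta>)) \<longlongrightarrow> l) (at_left 1)" by blast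
    show "\<zeta> \<in> G" unfolding G_def
    proof
      fix m
      define e where "e = inverse (real (Suc m))"
      have "eventually (\<lambda>r. dist (f (of_real r * \<zeta>)) l < e / 2) (at_left 1)"
        using l by (rule tendstoD) (simp add: e_def)
      then obtain b where b: "b < 1" "\<And>r. b < r \<Longrightarrow> r < 1 \<Longrightarrow> dist (f (of_real r * \<zeta>)) l < e / 2"
        using eventually_at_left[of 0 "1::real"] by auto
      obtain k where "inverse (real (Suc k)) < 1 - b" using reals_Archimedean[of "1 - b"] b by auto
      then have k: "rad k > b" by (simp add: rad_def)
      have "\<zeta> \<in> Q k m"
        unfolding Q_def e_def[symmetric]
      proof (intro CollectI conjI ballI \<zeta>)
        fix r s assume "r \<in> {rad k..<1}" "s \<in> {rad k..<1}"
        then have "dist (f (of_real r * \<zeta>)) l < e / 2" "dist (f (of_real s * \<zeta>)) l < e / 2" using b k by auto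
        then show "dist (f (of_real r * \<zeta>)) (f (of_real s * \<zeta>)) \<le> e"
          using dist_triangle2[of "f (of_real r * \<zeta>)" "f (of_real s * \<zeta>)" l] by linarith
      qed
      then show "\<zeta> \<in> (\<Union>k. Q k m)" by blast
    qed
  qed
  have eq: "boundary f \<zeta> = (if \<zeta> \<in> G then lim (\<lambda>k. f (of_real (rad k) * \<zeta>)) else (THE l. False))"
    if \<zeta>: "\<zeta> \<in> sphere 0 1" for \<zeta>
  proof (cases "\<zeta> \<in> G")
    case True
    then obtain l where l: "((\<lambda>r. f (of_real r * \<zeta>)) \<longlongrightarrow> l) (at_left 1)" using G_iff[OF \<zeta>] by blast
    then have "boundary f \<zeta> = l" unfolding boundary_def by (intro tendsto_Lim) auto
    moreover have "(\<lambda>k. f (of_real (rad k) * \<zeta>)) \<longlonglongrightarrow> l"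
      by (rule filterlim_compose[OF l filterlim_rad])
    ultimately show ?thesis using True by (simp add: limI)
  next
    case False
    then have "\<not> ((\<lambda>r. f (of_real r * \<zeta>)) \<longlongrightarrow> l) (at_left 1)" for l using G_iff[OF \<zeta>] by blast
    then show ?thesis using False unfolding boundary_def Topological_Spaces.Lim_def by simp
  qed
  have "(\<lambda>\<zeta>. if \<zeta> \<in> G then lim (\<lambda>k. f (of_real (rad k) * \<zeta>)) else (THE l. False)) \<in> borel_measurable circle_measure"
  proof (rule measurable_If_set)
    show "(\<lambda>\<zeta>. lim (\<lambda>k. f (of_real (rad k) * \<zeta>))) \<in> borel_measurable circle_measure"
      by (intro borel_measurable_lim_metric dilation_continuous_measurable hol rad_bounds)
    show "G \<inter> space circle_measure \<in> sets circle_measure" by (rule sets.Int[OF G sets.top])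
  qed simp
  then show ?thesis by (subst measurable_cong[OF eq]) auto
qed

lemma dilation_difference_powser:
  assumes "has_powser a f" "0 \<le> \<rho>" "\<rho> < 1"
  shows "has_powser (\<lambda>n. a n * (1 - of_real \<rho> ^ n)) (\<lambda>z. f z - f (of_real \<rho> * z))"
  unfolding has_powser_def
proof
  fix z :: complex assume z: "z \<in> ball 0 1"
  have "\<rho> * cmod z \<le> 1 * cmod z" using assms by (intro mult_right_mono) auto
  then have "of_real \<rho> * z \<in> ball 0 1" using z assms by (simp add: norm_mult)
  then have "(\<lambda>n. a n * z ^ n - a n * (of_real \<rho> * z) ^ n) sums (f z - f (of_real \<rho> * z))"
    using assms(1) z unfolding has_powser_def by (intro sums_diff) auto
  then show "(\<lambda>n. a n * (1 - of_real \<rho> ^ n) * z ^ n) sums (f z - f (of_real \<rho> * z))"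
    by (simp add: power_mult_distrib algebra_simps)
qed

lemma dilation_difference_summable:
  assumes summ: "summable (\<lambda>n. (cmod (a n))\<^sup>2)" and \<rho>: "0 \<le> \<rho>" "\<rho> < 1"
  shows "summable (\<lambda>n. (cmod (a n * (1 - of_real \<rho> ^ n)))\<^sup>2)"
    and "(cmod (a n * (1 - of_real \<rho> ^ n)))\<^sup>2 \<le> (cmod (a n))\<^sup>2"
proof -
  have le: "(cmod (a n * (1 - of_real \<rho> ^ n)))\<^sup>2 \<le> (cmod (a n))\<^sup>2" for n
  proof -
    have p: "0 \<le> \<rho> ^ n" "\<rho> ^ n \<le> 1" using \<rho> by (auto intro: power_le_one)
    have "cmod (1 - of_real \<rho> ^ n) = \<bar>1 - \<rho> ^ n\<bar>"
      by (metis norm_of_real of_real_1 of_real_diff of_real_power)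
    then have "cmod (1 - of_real \<rho> ^ n) \<le> 1" using p by simp
    then have "cmod (a n * (1 - of_real \<rho> ^ n)) \<le> cmod (a n)" by (simp add: norm_mult mult_left_le)
    then show ?thesis by (intro power_mono) auto
  qed
  then show "(cmod (a n * (1 - of_real \<rho> ^ n)))\<^sup>2 \<le> (cmod (a n))\<^sup>2" .
  show "summable (\<lambda>n. (cmod (a n * (1 - of_real \<rho> ^ n)))\<^sup>2)"
    by (rule summable_comparison_test'[OF summ, of 0]) (use le in simp)
qed

text \<open>
  Dominated convergence for series: every term tends to 0 and is at most \<open>|a n|^2\<close>.
\<close>
lemma dilation_difference_tendsto_0:
  assumes summ: "summable (\<lambda>n. (cmod (a n))\<^sup>2)"
  shows "((\<lambda>\<rho>::real. \<Sum>n. (cmod (a n * (1 - of_real \<rho> ^ n)))\<^sup>2) \<longlongrightarrow> 0) (at_left 1)"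
proof -
  have "((\<lambda>\<rho>::real. \<Sum>n. (cmod (a n * (1 - of_real \<rho> ^ n)))\<^sup>2) \<longlongrightarrow> (\<Sum>n::nat. 0)) (at_left 1)"
  proof (rule tannerys_theorem[THEN conjunct2, THEN conjunct2])
    fix k
    have "((\<lambda>\<rho>::real. (cmod (a k * (1 - of_real \<rho> ^ k)))\<^sup>2) \<longlongrightarrow> (cmod (a k * (1 - of_real 1 ^ k)))\<^sup>2) (at_left 1)"
      by (intro tendsto_intros)
    then show "((\<lambda>\<rho>::real. (cmod (a k * (1 - of_real \<rho> ^ k)))\<^sup>2) \<longlongrightarrow> 0) (at_left 1)" by simp
  next
    have "eventually (\<lambda>(k::nat, \<rho>::real). \<rho> \<in> {0..<1}) (at_top \<times>\<^sub>F at_left 1)"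
      using eventually_unit_interval_at_left_1 by (subst eventually_prod2) auto
    then show "eventually (\<lambda>(k, \<rho>). norm ((cmod (a k * (1 - of_real \<rho> ^ k)))\<^sup>2) \<le> (cmod (a k))\<^sup>2) (at_top \<times>\<^sub>F at_left 1)"
      by (rule eventually_mono) (use dilation_difference_summable(2)[OF summ] in auto)
  qed (use summ in auto)
  then show ?thesis by simp
qed

lemma L1_le_L2:
  assumes "\<phi> \<in> L2_circle"
  shows "(\<integral>\<^sup>+\<zeta>. cmod (\<phi> \<zeta>) \<partial>circle_measure) \<le> ennreal (sqrt (LINT \<zeta>|circle_measure. (cmod (\<phi> \<zeta>))\<^sup>2))"
proof -
  note [measurable] = L2_measurable[OF assms]
  define \<psi> where "\<psi> = (\<lambda>\<zeta>. complex_of_real (cmod (\<phi> \<zeta>)))"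
  have \<psi>: "\<psi> \<in> L2_circle" using assms by (auto simp: L2_circle_def \<psi>_def)
  have one: "(\<lambda>_. 1) \<in> L2_circle" by (intro continuous_L2 continuous_intros)
  have "integrable circle_measure (\<lambda>\<zeta>. norm (\<psi> \<zeta> * cnj 1))"
    using L2_product_integrable[OF \<psi> one] by (rule integrable_norm)
  then have int: "integrable circle_measure (\<lambda>\<zeta>. cmod (\<phi> \<zeta>))" by (simp add: \<psi>_def)
  have "L2_inner \<psi> (\<lambda>_. 1) = of_real (LINT \<zeta>|circle_measure. cmod (\<phi> \<zeta>))"
    by (simp add: L2_inner_def \<psi>_def)
  then have "(LINT \<zeta>|circle_measure. cmod (\<phi> \<zeta>))\<^sup>2 \<le> (LINT \<zeta>|circle_measure. (cmod (\<phi> \<zeta>))\<^sup>2)"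
    using L2_Cauchy_Schwarz[OF \<psi> one] circle.prob_space by (simp add: \<psi>_def)
  then have "(LINT \<zeta>|circle_measure. cmod (\<phi> \<zeta>)) \<le> sqrt (LINT \<zeta>|circle_measure. (cmod (\<phi> \<zeta>))\<^sup>2)"
    by (rule real_le_rsqrt)
  then show ?thesis by (subst nn_integral_eq_integral[OF int]) (auto intro: ennreal_leI)
qed

text \<open>
  Fatou's theorem. For a null set of \<open>\<zeta>\<close> to be discarded, one needs for each tolerance a \<open>\<rho>\<close> with
  \<open>f (r \<zeta>)\<close> and \<open>f (\<rho> r \<zeta>)\<close> close for all \<open>r\<close>. By the maximal inequality the set \<open>S \<rho> e\<close> where this
  fails has measure at most a constant times \<open>sqrt (T \<rho>) / e\<close>, where \<open>T \<rho>\<close> tends to 0 as \<open>\<rho>\<close> tends to 1; the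
  intersection over \<open>\<rho> = rad k\<close> is therefore null. Elsewhere \<open>f (r \<zeta>)\<close> is eventually close to
  \<open>f (\<rho> \<zeta>)\<close>, since \<open>f\<close> is continuous at \<open>\<rho> \<zeta>\<close>.
\<close>
lemma H2_radial_limit_AE:
  assumes f: "f \<in> H2"
  shows "AE \<zeta> in circle_measure. \<exists>l. ((\<lambda>r. f (of_real r * \<zeta>)) \<longlongrightarrow> l) (at_left (1::real))"
proof -
  obtain a where a: "has_powser a f" and summ: "summable (\<lambda>n. (cmod (a n))\<^sup>2)" using H2_powser[OF f] .
  define T where "T \<rho> = (\<Sum>n. (cmod (a n * (1 - of_real \<rho> ^ n)))\<^sup>2)" for \<rho> :: real
  have T0: "T \<rho> \<ge> 0" if "\<rho> \<in> {0..<1}" for \<rho>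
    unfolding T_def by (intro suminf_nonneg dilation_difference_summable[OF summ]) (use that in auto)
  define S where "S \<rho> e = {\<zeta>\<in>sphere 0 1. \<exists>r\<in>{0..<1}.
      cmod (f (of_real r * \<zeta>) - f (of_real \<rho> * (of_real r * \<zeta>))) > e}" for \<rho> e :: real
  have S: "S \<rho> e \<in> sets circle_measure" "emeasure circle_measure (S \<rho> e) \<le> ennreal (17280 * sqrt (T \<rho>) / e)"
    if \<rho>: "\<rho> \<in> {0..<1}" and e: "e > 0" for \<rho> e
  proof -
    define g where "g = (\<lambda>z. f z - f (of_real \<rho> * z))"
    have g: "has_powser (\<lambda>n. a n * (1 - of_real \<rho> ^ n)) g"
      unfolding g_def by (rule dilation_difference_powser[OF a]) (use \<rho> in auto)
    have hol: "g holomorphic_on ball 0 1" by (rule has_powser_holomorphic[OF g])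
    have "S \<rho> e = {\<zeta>\<in>sphere 0 1. \<exists>r\<in>{0..<1}. cmod (g (of_real r * \<zeta>)) > e}"
      by (simp add: S_def g_def)
    moreover have "(\<integral>\<^sup>+\<zeta>. cmod (g (of_real r * \<zeta>)) \<partial>circle_measure) \<le> ennreal (sqrt (T \<rho>))" if r: "r \<in> {0..<1}" for r
    proof -
      have "(\<integral>\<^sup>+\<zeta>. cmod (g (of_real r * \<zeta>)) \<partial>circle_measure) \<le>
          ennreal (sqrt (LINT \<zeta>|circle_measure. (cmod (g (of_real r * \<zeta>)))\<^sup>2))"
        by (intro L1_le_L2 dilation_L2 hol) (use r in auto)
      also have "\<dots> \<le> ennreal (sqrt (T \<rho>))" unfolding T_def
        by (intro ennreal_leI real_sqrt_le_mono dilation_square_le[OF g] dilation_difference_summable[OF summ])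
           (use r \<rho> in auto)
      finally show ?thesis .
    qed
    ultimately show "S \<rho> e \<in> sets circle_measure" "emeasure circle_measure (S \<rho> e) \<le> ennreal (17280 * sqrt (T \<rho>) / e)"
      using radial_superlevel_measurable[OF hol order_refl] radial_maximal_weak_type[OF hol e, of "sqrt (T \<rho>)"] T0[OF \<rho>]
      by auto
  qed
  define N where "N e = (\<Inter>k. S (rad k) e)" for e
  have "N e \<in> null_sets circle_measure" if e: "e > 0" for e
  proof -
    have meas: "N e \<in> sets circle_measure" unfolding N_def using S(1)[OF rad_bounds(3) e] by blast
    have "emeasure circle_measure (N e) \<le> ennreal (17280 * sqrt (T (rad k)) / e)" for k
    proof -
      have "emeasure circle_measure (N e) \<le> emeasure circle_measure (S (rad k) e)"
        using S(1)[OF rad_bounds(3) e] by (intro emeasure_mono) (auto simp: N_def)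
      then show ?thesis using S(2)[OF rad_bounds(3) e] by (rule order_trans)
    qed
    moreover have "(\<lambda>k. ennreal (17280 * sqrt (T (rad k)) / e)) \<longlonglongrightarrow> ennreal (17280 * sqrt 0 / e)"
      unfolding T_def
      by (intro tendsto_intros filterlim_compose[OF dilation_difference_tendsto_0[OF summ] filterlim_rad]) (use e in auto)
    ultimately have "emeasure circle_measure (N e) \<le> ennreal (17280 * sqrt 0 / e)"
      by (intro LIMSEQ_le_const) auto
    then show ?thesis using meas by (auto simp: null_sets_def)
  qed
  then have "AE \<zeta> in circle_measure. \<zeta> \<notin> N (inverse (real (Suc m)))" for m by (intro AE_not_in) simp
  then have "AE \<zeta> in circle_measure. \<forall>m. \<zeta> \<notin> N (inverse (real (Suc m)))" by (simp add: AE_all_countable)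
  moreover have "AE \<zeta> in circle_measure. \<zeta> \<in> sphere 0 1" by (rule AE_I2) simp
  ultimately show ?thesis
  proof eventually_elim
    case (elim \<zeta>)
    show ?case
    proof (rule tendsto_exists_of_approx)
      fix e :: real assume "e > 0"
      then obtain m where m: "inverse (real (Suc m)) < e / 2" using reals_Archimedean[of "e / 2"] by auto
      obtain k where k: "\<zeta> \<notin> S (rad k) (inverse (real (Suc m)))" using elim by (auto simp: N_def)
      define \<rho> where "\<rho> = rad k"
      have \<rho>: "0 \<le> \<rho>" "\<rho> < 1" by (auto simp: \<rho>_def rad_bounds)
      have "isCont f (of_real \<rho> * \<zeta>)"
      proof (rule continuous_on_interior[OF holomorphic_on_imp_continuous_on[OF has_powser_holomorphic[OF a]]])
        show "of_real \<rho> * \<zeta> \<in> interior (ball 0 1)" using \<rho> elim by (simp add: norm_mult)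
      qed
      then have "((\<lambda>r. f (of_real \<rho> * (of_real r * \<zeta>))) \<longlongrightarrow> f (of_real \<rho> * \<zeta>)) (at_left (1::real))"
        by (rule isCont_tendsto_compose) (auto intro!: tendsto_eq_intros)
      then have "eventually (\<lambda>r. dist (f (of_real \<rho> * (of_real r * \<zeta>))) (f (of_real \<rho> * \<zeta>)) < e / 2) (at_left (1::real))"
        using \<open>e > 0\<close> by (intro tendstoD) auto
      then have "eventually (\<lambda>r. dist (f (of_real r * \<zeta>)) (f (of_real \<rho> * \<zeta>)) < e) (at_left (1::real))"
        using eventually_unit_interval_at_left_1
      proof eventually_elim
        case (elim r)
        have "dist (f (of_real r * \<zeta>)) (f (of_real \<rho> * (of_real r * \<zeta>))) \<le> inverse (real (Suc m))"
          using k elim \<open>\<zeta> \<in> sphere 0 1\<close> by (auto simp: S_def \<rho>_def dist_norm not_less)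
        then show ?case using elim m
            dist_triangle[of "f (of_real r * \<zeta>)" "f (of_real \<rho> * \<zeta>)" "f (of_real \<rho> * (of_real r * \<zeta>))"] by linarith
      qed
      then show "\<exists>c. eventually (\<lambda>r. dist (f (of_real r * \<zeta>)) c < e) (at_left (1::real))" by blast
    qed simp
  qed
qed

lemma boundary_eqI: "((\<lambda>r. f (of_real r * \<zeta>)) \<longlongrightarrow> l) (at_left (1::real)) \<Longrightarrow> boundary f \<zeta> = l"
  unfolding boundary_def by (intro tendsto_Lim) auto

lemma H2_tendsto_boundary_AE:
  "f \<in> H2 \<Longrightarrow> AE \<zeta> in circle_measure. ((\<lambda>r. f (of_real r * \<zeta>)) \<longlongrightarrow> boundary f \<zeta>) (at_left (1::real))"
  using H2_radial_limit_AE[of f] by (auto elim!: eventually_mono dest: boundary_eqI)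

section \<open>Boundary functions\<close>

lemma Fatou_L2:
  assumes F: "\<And>k. F k \<in> L2_circle" and G: "G \<in> borel_measurable circle_measure"
    and lim: "AE \<zeta> in circle_measure. (\<lambda>k. F k \<zeta>) \<longlonglongrightarrow> G \<zeta>"
    and C: "\<And>k. (LINT \<zeta>|circle_measure. (cmod (F k \<zeta>))\<^sup>2) \<le> C"
  shows "G \<in> L2_circle" and "(LINT \<zeta>|circle_measure. (cmod (G \<zeta>))\<^sup>2) \<le> C"
proof -
  note [measurable] = F[THEN L2_measurable] G
  have "(\<integral>\<^sup>+\<zeta>. ennreal ((cmod (G \<zeta>))\<^sup>2) \<partial>circle_measure) \<le> (\<integral>\<^sup>+\<zeta>. liminf (\<lambda>k. ennreal ((cmod (F k \<zeta>))\<^sup>2)) \<partial>circle_measure)"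
  proof (rule nn_integral_mono_AE, use lim in eventually_elim)
    case (elim \<zeta>)
    then have "(\<lambda>k. ennreal ((cmod (F k \<zeta>))\<^sup>2)) \<longlonglongrightarrow> ennreal ((cmod (G \<zeta>))\<^sup>2)"
      by (intro tendsto_ennrealI tendsto_intros)
    then show ?case by (subst lim_imp_Liminf[OF sequentially_bot]) auto
  qed
  also have "\<dots> \<le> liminf (\<lambda>k. \<integral>\<^sup>+\<zeta>. ennreal ((cmod (F k \<zeta>))\<^sup>2) \<partial>circle_measure)"
    by (rule nn_integral_liminf) measurable
  also have "\<dots> \<le> liminf (\<lambda>k::nat. ennreal C)"
  proof (intro Liminf_mono always_eventually allI)
    fix k
    show "(\<integral>\<^sup>+\<zeta>. ennreal ((cmod (F k \<zeta>))\<^sup>2) \<partial>circle_measure) \<le> ennreal C"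
      by (subst nn_integral_eq_integral[OF L2_integrable_square[OF F]]) (use C in \<open>auto intro: ennreal_leI\<close>)
  qed
  also have "\<dots> = ennreal C" by (simp add: Liminf_const)
  finally have le: "(\<integral>\<^sup>+\<zeta>. ennreal ((cmod (G \<zeta>))\<^sup>2) \<partial>circle_measure) \<le> ennreal C" .
  have int: "integrable circle_measure (\<lambda>\<zeta>. (cmod (G \<zeta>))\<^sup>2)"
  proof (rule integrableI_bounded)
    show "(\<integral>\<^sup>+\<zeta>. ennreal (norm ((cmod (G \<zeta>))\<^sup>2)) \<partial>circle_measure) < \<infinity>"
      using le by (simp add: le_less_trans)
  qed measurable
  then show "G \<in> L2_circle" by (simp add: L2_circle_def)
  have "0 \<le> (LINT \<zeta>|circle_measure. (cmod (F 0 \<zeta>))\<^sup>2)" by simp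
  also have "\<dots> \<le> C" by (rule C)
  finally have "0 \<le> C" .
  then show "(LINT \<zeta>|circle_measure. (cmod (G \<zeta>))\<^sup>2) \<le> C"
    using le by (subst (asm) nn_integral_eq_integral[OF int]) auto
qed

lemma H2_holomorphic: "f \<in> H2 \<Longrightarrow> f holomorphic_on ball 0 1" by (simp add: H2_def)

lemma H2_dilation_L2: "f \<in> H2 \<Longrightarrow> 0 \<le> r \<Longrightarrow> r < 1 \<Longrightarrow> (\<lambda>\<zeta>. f (of_real r * \<zeta>)) \<in> L2_circle"
  by (intro dilation_L2 H2_holomorphic)

text \<open>
  The function \<open>f z - f (\<rho> z)\<close> has coefficients \<open>a n (1 - \<rho> ^ n)\<close> and the radial limits
  of the left hand side, so Fatou's lemma passes Parseval's identity to the boundary.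
\<close>
lemma boundary_minus_dilation:
  assumes f: "f \<in> H2" and a: "has_powser a f" and summ: "summable (\<lambda>n. (cmod (a n))\<^sup>2)" and \<rho>: "0 \<le> \<rho>" "\<rho> < 1"
  shows "(\<lambda>\<zeta>. boundary f \<zeta> - f (of_real \<rho> * \<zeta>)) \<in> L2_circle"
    and "(LINT \<zeta>|circle_measure. (cmod (boundary f \<zeta> - f (of_real \<rho> * \<zeta>)))\<^sup>2) \<le> (\<Sum>n. (cmod (a n * (1 - of_real \<rho> ^ n)))\<^sup>2)"
proof -
  define g where "g = (\<lambda>z. f z - f (of_real \<rho> * z))"
  have g: "has_powser (\<lambda>n. a n * (1 - of_real \<rho> ^ n)) g"
    unfolding g_def by (rule dilation_difference_powser[OF a \<rho>])
  have hol: "g holomorphic_on ball 0 1" by (rule has_powser_holomorphic[OF g])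
  have 1: "(\<lambda>\<zeta>. g (of_real (rad k) * \<zeta>)) \<in> L2_circle" for k
    by (intro dilation_L2 hol rad_bounds)
  have 2: "(\<lambda>\<zeta>. boundary f \<zeta> - f (of_real \<rho> * \<zeta>)) \<in> borel_measurable circle_measure"
    by (intro borel_measurable_diff boundary_measurable dilation_continuous_measurable H2_holomorphic f \<rho>)
  have "AE \<zeta> in circle_measure. \<zeta> \<in> sphere 0 1" by (rule AE_I2) simp
  with H2_tendsto_boundary_AE[OF f]
  have 3: "AE \<zeta> in circle_measure. (\<lambda>k. g (of_real (rad k) * \<zeta>)) \<longlonglongrightarrow> boundary f \<zeta> - f (of_real \<rho> * \<zeta>)"
  proof eventually_elim
    case (elim \<zeta>)
    have "isCont f (of_real \<rho> * \<zeta>)"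
    proof (rule continuous_on_interior[OF holomorphic_on_imp_continuous_on[OF has_powser_holomorphic[OF a]]])
      show "of_real \<rho> * \<zeta> \<in> interior (ball 0 1)" using \<rho> elim by (simp add: norm_mult)
    qed
    then have "((\<lambda>r. f (of_real \<rho> * (of_real r * \<zeta>))) \<longlongrightarrow> f (of_real \<rho> * \<zeta>)) (at_left (1::real))"
      by (rule isCont_tendsto_compose) (auto intro!: tendsto_eq_intros)
    with elim(1) have "((\<lambda>r. g (of_real r * \<zeta>)) \<longlongrightarrow> boundary f \<zeta> - f (of_real \<rho> * \<zeta>)) (at_left (1::real))"
      unfolding g_def by (intro tendsto_diff)
    then show ?case by (rule filterlim_compose[OF _ filterlim_rad])
  qed
  have 4: "(LINT \<zeta>|circle_measure. (cmod (g (of_real (rad k) * \<zeta>)))\<^sup>2) \<le> (\<Sum>n. (cmod (a n * (1 - of_real \<rho> ^ n)))\<^sup>2)" for k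
    by (intro dilation_square_le[OF g] dilation_difference_summable[OF summ] \<rho> rad_bounds)
  show "(\<lambda>\<zeta>. boundary f \<zeta> - f (of_real \<rho> * \<zeta>)) \<in> L2_circle"
    and "(LINT \<zeta>|circle_measure. (cmod (boundary f \<zeta> - f (of_real \<rho> * \<zeta>)))\<^sup>2) \<le> (\<Sum>n. (cmod (a n * (1 - of_real \<rho> ^ n)))\<^sup>2)"
    by (rule Fatou_L2[OF 1 2 3 4])+
qed

lemma boundary_L2: assumes f: "f \<in> H2" shows "boundary f \<in> L2_circle"
proof -
  obtain a where a: "has_powser a f" "summable (\<lambda>n. (cmod (a n))\<^sup>2)" using H2_powser[OF f] .
  have "(\<lambda>\<zeta>. (boundary f \<zeta> - f (of_real 0 * \<zeta>)) + f (of_real 0 * \<zeta>)) \<in> L2_circle"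
    by (intro L2_add boundary_minus_dilation(1)[OF f a] H2_dilation_L2 f) auto
  then show ?thesis by simp
qed

text \<open>
  Cauchy-Schwarz, with the mean square distance of the boundary function from the dilation.
\<close>
lemma L2_inner_dilation_tendsto:
  assumes f: "f \<in> H2" and \<psi>: "\<psi> \<in> L2_circle"
  shows "((\<lambda>\<rho>. L2_inner \<psi> (\<lambda>\<zeta>. f (of_real \<rho> * \<zeta>))) \<longlongrightarrow> L2_inner \<psi> (boundary f)) (at_left (1::real))"
proof -
  obtain a where a: "has_powser a f" and summ: "summable (\<lambda>n. (cmod (a n))\<^sup>2)" using H2_powser[OF f] .
  define N where "N = (LINT \<zeta>|circle_measure. (cmod (\<psi> \<zeta>))\<^sup>2)"
  define T where "T \<rho> = (\<Sum>n. (cmod (a n * (1 - of_real \<rho> ^ n)))\<^sup>2)" for \<rho> :: real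
  have "((\<lambda>\<rho>. L2_inner \<psi> (boundary f) - L2_inner \<psi> (\<lambda>\<zeta>. f (of_real \<rho> * \<zeta>))) \<longlongrightarrow> 0) (at_left (1::real))"
  proof (rule Lim_null_comparison)
    show "((\<lambda>\<rho>. sqrt (N * T \<rho>)) \<longlongrightarrow> 0) (at_left (1::real))"
      using tendsto_real_sqrt[OF tendsto_mult_left[OF dilation_difference_tendsto_0[OF summ], of N]]
      by (simp add: T_def)
    show "eventually (\<lambda>\<rho>. norm (L2_inner \<psi> (boundary f) - L2_inner \<psi> (\<lambda>\<zeta>. f (of_real \<rho> * \<zeta>))) \<le> sqrt (N * T \<rho>)) (at_left (1::real))"
      using eventually_unit_interval_at_left_1
    proof eventually_elim
      case (elim \<rho>)
      then have \<rho>: "0 \<le> \<rho>" "\<rho> < 1" by auto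
      note d = boundary_minus_dilation[OF f a summ \<rho>]
      have "L2_inner \<psi> (boundary f) - L2_inner \<psi> (\<lambda>\<zeta>. f (of_real \<rho> * \<zeta>)) = L2_inner \<psi> (\<lambda>\<zeta>. boundary f \<zeta> - f (of_real \<rho> * \<zeta>))"
        by (rule L2_inner_diff_right[symmetric]) (intro \<psi> boundary_L2 H2_dilation_L2 f \<rho>)+
      moreover have "(cmod (L2_inner \<psi> (\<lambda>\<zeta>. boundary f \<zeta> - f (of_real \<rho> * \<zeta>))))\<^sup>2 \<le> N * T \<rho>"
        unfolding N_def T_def
        by (rule order_trans[OF L2_Cauchy_Schwarz[OF \<psi> d(1)] mult_left_mono[OF d(2)]]) simp
      ultimately show ?case by (simp add: real_le_rsqrt)
    qed
  qed
  from tendsto_diff[OF tendsto_const[of "L2_inner \<psi> (boundary f)"] this] show ?thesis by simp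
qed

lemma L2_inner_monomial_boundary:
  assumes f: "f \<in> H2" and a: "has_powser a f"
  shows "L2_inner (\<lambda>\<zeta>. \<zeta> ^ n) (boundary f) = cnj (a n)"
proof (rule tendsto_unique)
  show "((\<lambda>\<rho>. L2_inner (\<lambda>\<zeta>. \<zeta> ^ n) (\<lambda>\<zeta>. f (of_real \<rho> * \<zeta>))) \<longlongrightarrow> L2_inner (\<lambda>\<zeta>. \<zeta> ^ n) (boundary f)) (at_left (1::real))"
    by (intro L2_inner_dilation_tendsto f continuous_L2 continuous_intros)
  have "((\<lambda>\<rho>. cnj (a n) * of_real \<rho> ^ n) \<longlongrightarrow> cnj (a n) * of_real 1 ^ n) (at_left (1::real))"
    by (intro tendsto_intros)
  then have "((\<lambda>\<rho>. cnj (a n) * of_real \<rho> ^ n) \<longlongrightarrow> cnj (a n)) (at_left (1::real))" by simp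
  moreover have "eventually (\<lambda>\<rho>. cnj (a n) * of_real \<rho> ^ n = L2_inner (\<lambda>\<zeta>. \<zeta> ^ n) (\<lambda>\<zeta>. f (of_real \<rho> * \<zeta>))) (at_left (1::real))"
    using eventually_unit_interval_at_left_1
    by eventually_elim (simp add: L2_inner_dilation_monomial[OF a])
  ultimately show "((\<lambda>\<rho>. L2_inner (\<lambda>\<zeta>. \<zeta> ^ n) (\<lambda>\<zeta>. f (of_real \<rho> * \<zeta>))) \<longlongrightarrow> cnj (a n)) (at_left (1::real))"
    by (rule Lim_transform_eventually)
qed simp

section \<open>The orthogonal projection\<close>

text \<open>
  Square integrability is included because the integral in \<^const>\<open>L2_inner\<close> is a default value
  when the product is not integrable.
\<close>
definition H2_orth :: "(complex \<Rightarrow> complex) \<Rightarrow> bool" where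
  "H2_orth \<phi> \<longleftrightarrow> \<phi> \<in> L2_circle \<and> (\<forall>k\<in>H2. L2_inner \<phi> (boundary k) = 0)"

text \<open>
  The inner product with each dilation of \<open>k\<close> is a series of vanishing terms, and these inner products
  converge to the one with the boundary function of \<open>k\<close>.
\<close>
lemma H2_orthI_monomials:
  assumes \<phi>: "\<phi> \<in> L2_circle" and orth: "\<And>n. L2_inner \<phi> (\<lambda>\<zeta>. \<zeta> ^ n) = 0"
  shows "H2_orth \<phi>"
  unfolding H2_orth_def
proof (intro conjI ballI \<phi>)
  fix k assume k: "k \<in> H2"
  obtain b where b: "has_powser b k" using has_powser_exists[OF H2_holomorphic[OF k]] by blast
  have "integrable circle_measure \<phi>"
    using L2_product_integrable[OF \<phi>, of "\<lambda>_. 1"] by (simp add: continuous_L2)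
  from L2_inner_dilation_sums[OF b _ _ this]
  have "(\<lambda>n::nat. 0) sums L2_inner \<phi> (\<lambda>\<zeta>. k (of_real \<rho> * \<zeta>))" if "0 \<le> \<rho>" "\<rho> < 1" for \<rho>
    using that by (simp add: orth)
  then have "L2_inner \<phi> (\<lambda>\<zeta>. k (of_real \<rho> * \<zeta>)) = 0" if "\<rho> \<in> {0..<1}" for \<rho>
    using that sums_unique2[OF sums_zero] by fastforce
  then have "eventually (\<lambda>\<rho>. L2_inner \<phi> (\<lambda>\<zeta>. k (of_real \<rho> * \<zeta>)) = 0) (at_left (1::real))"
    using eventually_unit_interval_at_left_1 by (auto elim: eventually_mono)
  from tendsto_unique[OF _ L2_inner_dilation_tendsto[OF k \<phi>] tendsto_eventually[OF this]]
  show "L2_inner \<phi> (boundary k) = 0" by simp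
qed

lemma H2_zero_outside: "f \<in> H2 \<Longrightarrow> z \<notin> ball 0 1 \<Longrightarrow> f z = 0"
  by (simp add: H2_def)

lemma H2_eqI:
  assumes f: "f \<in> H2" and h: "h \<in> H2"
    and eq: "\<And>n. L2_inner (\<lambda>\<zeta>. \<zeta> ^ n) (boundary f) = L2_inner (\<lambda>\<zeta>. \<zeta> ^ n) (boundary h)"
  shows "f = h"
proof
  obtain a where a: "has_powser a f" using has_powser_exists[OF H2_holomorphic[OF f]] by blast
  obtain b where b: "has_powser b h" using has_powser_exists[OF H2_holomorphic[OF h]] by blast
  have "a n = b n" for n
    using eq[of n] by (simp add: L2_inner_monomial_boundary[OF f a] L2_inner_monomial_boundary[OF h b])
  then have "a = b" by auto
  fix z
  show "f z = h z"
  proof (cases "z \<in> ball 0 1")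
    case True
    then show ?thesis using a b \<open>a = b\<close> unfolding has_powser_def by (metis sums_unique2)
  next
    case False
    then show ?thesis using H2_zero_outside[OF f] H2_zero_outside[OF h] by metis
  qed
qed

lemma disc_monomial:
  fixes n :: nat
  defines "m \<equiv> \<lambda>z::complex. if z \<in> ball 0 1 then z ^ n else 0"
  shows "m \<in> H2" and "\<And>\<zeta>. \<zeta> \<in> sphere 0 1 \<Longrightarrow> boundary m \<zeta> = \<zeta> ^ n"
proof -
  have "has_powser (\<lambda>k. if k = n then 1 else 0) m"
    unfolding has_powser_def
  proof
    fix z :: complex assume "z \<in> ball 0 1"
    moreover have "(\<lambda>k. if k = n then z ^ k else 0) sums z ^ n" by (rule sums_single)
    moreover have "(\<lambda>k. (if k = n then 1 else 0) * z ^ k) = (\<lambda>k. if k = n then z ^ k else 0)" by auto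
    ultimately show "(\<lambda>k. (if k = n then 1 else 0) * z ^ k) sums m z" by (simp add: m_def)
  qed
  moreover have "summable (\<lambda>k. (cmod (if k = n then 1 else 0))\<^sup>2)"
    by (rule summable_finite[of "{n}"]) auto
  ultimately show "m \<in> H2" by (rule H2I_powser) (simp add: m_def)
  fix \<zeta> :: complex assume \<zeta>: "\<zeta> \<in> sphere 0 1"
  show "boundary m \<zeta> = \<zeta> ^ n"
  proof (rule boundary_eqI, rule Lim_transform_eventually)
    have "((\<lambda>r. (of_real r * \<zeta>) ^ n) \<longlongrightarrow> (of_real 1 * \<zeta>) ^ n) (at_left (1::real))" by (intro tendsto_intros)
    then show "((\<lambda>r. (of_real r * \<zeta>) ^ n) \<longlongrightarrow> \<zeta> ^ n) (at_left (1::real))" by simp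
    show "eventually (\<lambda>r. (of_real r * \<zeta>) ^ n = m (of_real r * \<zeta>)) (at_left (1::real))"
      using eventually_unit_interval_at_left_1 by eventually_elim (use \<zeta> in \<open>simp add: m_def norm_mult\<close>)
  qed
qed

lemma H2_orth_monomial:
  assumes "H2_orth \<phi>"
  shows "L2_inner \<phi> (\<lambda>\<zeta>. \<zeta> ^ n) = 0"
proof -
  have "L2_inner \<phi> (boundary (\<lambda>z. if z \<in> ball 0 1 then z ^ n else 0)) = 0"
    using assms disc_monomial(1)[of n] by (auto simp: H2_orth_def)
  moreover have "L2_inner \<phi> (boundary (\<lambda>z. if z \<in> ball 0 1 then z ^ n else 0)) = L2_inner \<phi> (\<lambda>\<zeta>. \<zeta> ^ n)"
    unfolding L2_inner_def
    by (rule Bochner_Integration.integral_cong) (use disc_monomial(2)[of _ n] in auto)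
  ultimately show ?thesis by simp
qed

lemma H2_projection_unique:
  assumes \<phi>: "\<phi> \<in> L2_circle" and f: "f \<in> H2" "H2_orth (\<lambda>\<zeta>. \<phi> \<zeta> - boundary f \<zeta>)"
    and h: "h \<in> H2" "H2_orth (\<lambda>\<zeta>. \<phi> \<zeta> - boundary h \<zeta>)"
  shows "f = h"
proof (rule H2_eqI[OF f(1) h(1)])
  fix n
  have m: "(\<lambda>\<zeta>. \<zeta> ^ n) \<in> L2_circle" by (intro continuous_L2 continuous_intros)
  have "L2_inner (boundary k) (\<lambda>\<zeta>. \<zeta> ^ n) = L2_inner \<phi> (\<lambda>\<zeta>. \<zeta> ^ n)"
    if "k \<in> H2" "H2_orth (\<lambda>\<zeta>. \<phi> \<zeta> - boundary k \<zeta>)" for k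
    using H2_orth_monomial[OF that(2), of n] L2_inner_diff_left[OF \<phi> boundary_L2[OF that(1)] m] by simp
  then show "L2_inner (\<lambda>\<zeta>. \<zeta> ^ n) (boundary f) = L2_inner (\<lambda>\<zeta>. \<zeta> ^ n) (boundary h)"
    using f h by (simp add: L2_inner_commute[of "\<lambda>\<zeta>. \<zeta> ^ n"])
qed

text \<open>
  The projection \<open>h\<close> has the nonnegative Fourier coefficients \<open>a n\<close> of \<open>\<phi>\<close> as Taylor coefficients. To bound
  its mean squares, note that \<open>X r = \<Sum> |a n|^2 r ^ (2 n)\<close> is both the mean square of \<open>h\<close> at radius \<open>r\<close>
  and the inner product of \<open>\<phi>\<close> with the dilation of \<open>h\<close> by \<open>r^2\<close>. Cauchy-Schwarz then gives
  \<open>X r ^ 2 \<le> N \<cdot> X (r^2) \<le> N \<cdot> X r\<close>, that is, Bessel's inequality.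
\<close>
lemma H2_projection_exists:
  assumes \<phi>: "\<phi> \<in> L2_circle"
  shows "\<exists>h\<in>H2. H2_orth (\<lambda>\<zeta>. \<phi> \<zeta> - boundary h \<zeta>)"
proof -
  define a where "a n = L2_inner \<phi> (\<lambda>\<zeta>. \<zeta> ^ n)" for n
  define N where "N = (LINT \<zeta>|circle_measure. (cmod (\<phi> \<zeta>))\<^sup>2)"
  have N0: "N \<ge> 0" by (simp add: N_def)
  have m: "(\<lambda>\<zeta>. \<zeta> ^ n) \<in> L2_circle" for n by (intro continuous_L2 continuous_intros)
  have intphi: "integrable circle_measure \<phi>"
    using L2_product_integrable[OF \<phi>, of "\<lambda>_. 1"] by (simp add: continuous_L2)
  have "(LINT \<zeta>|circle_measure. (cmod (\<zeta> ^ n))\<^sup>2) = 1" for n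
    using L2_inner_self[of "\<lambda>\<zeta>. \<zeta> ^ n"] L2_inner_monomials[of n n] by (simp only: of_real_eq_1_iff) simp
  then have "(cmod (a n))\<^sup>2 \<le> N" for n
    using L2_Cauchy_Schwarz[OF \<phi> m, of n] by (simp add: a_def N_def)
  then have abound: "cmod (a n) \<le> sqrt N" for n by (rule real_le_rsqrt)
  define h where "h z = (if z \<in> ball 0 1 then \<Sum>n. a n * z ^ n else 0)" for z
  have ps: "has_powser a h"
    unfolding has_powser_def
  proof
    fix z :: complex assume z: "z \<in> ball 0 1"
    have "summable (\<lambda>n. a n * z ^ n)"
    proof (rule summable_comparison_test')
      show "summable (\<lambda>n. sqrt N * cmod z ^ n)" using z by (intro summable_mult summable_geometric) auto
      show "norm (a n * z ^ n) \<le> sqrt N * cmod z ^ n" for n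
        using abound[of n] by (simp add: norm_mult norm_power mult_right_mono)
    qed
    then show "(\<lambda>n. a n * z ^ n) sums h z" using z by (simp add: h_def summable_sums)
  qed
  have hol: "h holomorphic_on ball 0 1" by (rule has_powser_holomorphic[OF ps])
  have bound: "(LINT \<zeta>|circle_measure. (cmod (h (of_real r * \<zeta>)))\<^sup>2) \<le> N" if r: "r \<in> {0..<1}" for r
  proof -
    define X where "X s = (LINT \<zeta>|circle_measure. (cmod (h (of_real s * \<zeta>)))\<^sup>2)" for s
    have X0: "X s \<ge> 0" for s by (simp add: X_def)
    have r2: "0 \<le> r\<^sup>2" "r\<^sup>2 < 1" "r\<^sup>2 \<le> r" "0 \<le> r" "r < 1"
    proof -
      have "r * r \<le> r * 1" using r by (intro mult_left_mono) auto
      then show "r\<^sup>2 \<le> r" by (simp add: power2_eq_square)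
      then show "r\<^sup>2 < 1" using r by auto
    qed (use r in auto)
    have sX: "(\<lambda>n. (cmod (a n))\<^sup>2 * (s ^ n)\<^sup>2) sums X s" if "0 \<le> s" "s < 1" for s
      unfolding X_def by (rule parseval_dilation[OF ps that])
    have "X (r\<^sup>2) \<le> X r"
    proof (rule sums_le[OF _ sX sX])
      fix n show "(cmod (a n))\<^sup>2 * ((r\<^sup>2) ^ n)\<^sup>2 \<le> (cmod (a n))\<^sup>2 * (r ^ n)\<^sup>2"
        using r2 by (intro mult_left_mono power_mono) auto
    qed (use r2 in auto)
    have "(\<lambda>n. cnj (a n) * of_real (r\<^sup>2) ^ n * a n) sums L2_inner \<phi> (\<lambda>\<zeta>. h (of_real (r\<^sup>2) * \<zeta>))"
      unfolding a_def by (rule L2_inner_dilation_sums[OF ps[unfolded a_def] r2(1,2) intphi])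
    moreover have "cnj (a n) * of_real (r\<^sup>2) ^ n * a n = of_real ((cmod (a n))\<^sup>2 * (r ^ n)\<^sup>2)" for n
    proof -
      have "cnj (a n) * of_real (r\<^sup>2) ^ n * a n = (a n * cnj (a n)) * of_real ((r ^ n)\<^sup>2)"
        by (simp add: power2_eq_square power_mult_distrib)
      then show ?thesis by (simp only: of_real_mult complex_norm_square)
    qed
    ultimately have "(\<lambda>n. complex_of_real ((cmod (a n))\<^sup>2 * (r ^ n)\<^sup>2)) sums L2_inner \<phi> (\<lambda>\<zeta>. h (of_real (r\<^sup>2) * \<zeta>))"
      by (simp only:)
    moreover have "(\<lambda>n. complex_of_real ((cmod (a n))\<^sup>2 * (r ^ n)\<^sup>2)) sums complex_of_real (X r)"
      using sX[OF r2(4,5)] by (simp only: sums_of_real_iff)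
    ultimately have "L2_inner \<phi> (\<lambda>\<zeta>. h (of_real (r\<^sup>2) * \<zeta>)) = complex_of_real (X r)"
      by (rule sums_unique2)
    then have "(X r)\<^sup>2 \<le> N * X (r\<^sup>2)"
      using L2_Cauchy_Schwarz[OF \<phi> dilation_L2[OF hol r2(1,2)]] X0 by (simp add: N_def X_def)
    also have "\<dots> \<le> N * X r" by (intro mult_left_mono N0) fact
    finally have "X r * X r \<le> N * X r" by (simp add: power2_eq_square)
    then have "X r \<le> N" using X0[of r] N0 by (cases "X r = 0") auto
    then show ?thesis by (simp add: X_def)
  qed
  have "\<forall>z. z \<notin> ball 0 1 \<longrightarrow> h z = 0" by (simp add: h_def)
  then have h: "h \<in> H2" unfolding H2_def using hol bound by blast
  have "H2_orth (\<lambda>\<zeta>. \<phi> \<zeta> - boundary h \<zeta>)"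
  proof (rule H2_orthI_monomials)
    show "(\<lambda>\<zeta>. \<phi> \<zeta> - boundary h \<zeta>) \<in> L2_circle" by (intro L2_diff \<phi> boundary_L2 h)
    fix n
    have "L2_inner (boundary h) (\<lambda>\<zeta>. \<zeta> ^ n) = a n"
      using L2_inner_monomial_boundary[OF h ps, of n] by (simp add: L2_inner_commute[of "boundary h"])
    then show "L2_inner (\<lambda>\<zeta>. \<phi> \<zeta> - boundary h \<zeta>) (\<lambda>\<zeta>. \<zeta> ^ n) = 0"
      using L2_inner_diff_left[OF \<phi> boundary_L2[OF h] m[of n]] by (simp add: a_def)
  qed
  then show ?thesis using h by blast
qed

lemma H2_proj_eqI:
  assumes "\<phi> \<in> L2_circle" "h \<in> H2" "H2_orth (\<lambda>\<zeta>. \<phi> \<zeta> - boundary h \<zeta>)"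
  shows "H2_proj \<phi> = h"
  unfolding H2_proj_def
proof (rule the_equality)
  show "h \<in> H2 \<and> (\<forall>k\<in>H2. L2_inner (\<lambda>\<zeta>. \<phi> \<zeta> - boundary h \<zeta>) (boundary k) = 0)"
    using assms by (auto simp: H2_orth_def)
  fix f assume "f \<in> H2 \<and> (\<forall>k\<in>H2. L2_inner (\<lambda>\<zeta>. \<phi> \<zeta> - boundary f \<zeta>) (boundary k) = 0)"
  then have "f \<in> H2" "H2_orth (\<lambda>\<zeta>. \<phi> \<zeta> - boundary f \<zeta>)"
    using assms by (auto simp: H2_orth_def intro: L2_diff boundary_L2)
  then show "f = h" using H2_projection_unique assms by blast
qed

lemma H2_proj_props:
  assumes "\<phi> \<in> L2_circle"
  shows "H2_proj \<phi> \<in> H2" "H2_orth (\<lambda>\<zeta>. \<phi> \<zeta> - boundary (H2_proj \<phi>) \<zeta>)"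
  using H2_projection_exists[OF assms] H2_proj_eqI[OF assms] by auto

section \<open>Bounded analytic multipliers and the vector space H2\<close>

lemma H2_orth_cong_AE:
  assumes "H2_orth \<phi>" "\<psi> \<in> borel_measurable circle_measure" "AE \<zeta> in circle_measure. \<phi> \<zeta> = \<psi> \<zeta>"
  shows "H2_orth \<psi>"
  unfolding H2_orth_def
proof (intro conjI ballI)
  have \<phi>: "\<phi> \<in> L2_circle" using assms(1) by (simp add: H2_orth_def)
  show \<psi>: "\<psi> \<in> L2_circle" by (rule L2_cong_AE[OF \<phi> assms(2,3)])
  fix k assume k: "k \<in> H2"
  have "L2_inner \<psi> (boundary k) = L2_inner \<phi> (boundary k)"
    by (rule L2_inner_cong_AE) (use assms(3) \<phi> \<psi> boundary_L2[OF k] in \<open>auto elim: eventually_mono\<close>)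
  then show "L2_inner \<psi> (boundary k) = 0" using assms(1) k by (simp add: H2_orth_def)
qed

lemma H2_orth_add: "H2_orth \<phi> \<Longrightarrow> H2_orth \<psi> \<Longrightarrow> H2_orth (\<lambda>\<zeta>. \<phi> \<zeta> + \<psi> \<zeta>)"
  by (auto simp: H2_orth_def L2_add L2_inner_add_left boundary_L2)

lemma H2_orth_scale: "H2_orth \<phi> \<Longrightarrow> H2_orth (\<lambda>\<zeta>. c * \<phi> \<zeta>)"
  by (auto simp: H2_orth_def L2_scale L2_inner_scale_left)

lemma AE_circle: "AE \<zeta> in circle_measure. \<zeta> \<in> sphere 0 1"
  by (rule AE_I2) simp

lemma Hinf_times_H2:
  assumes f: "f \<in> Hinf" and h: "h \<in> H2"
  shows "(\<lambda>z. f z * h z) \<in> H2"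
proof -
  have holf: "f holomorphic_on ball 0 1" and "bounded (f ` ball 0 1)" using f by (auto simp: Hinf_def)
  then obtain B where B: "\<forall>z\<in>ball 0 1. cmod (f z) \<le> B" by (auto simp: bounded_iff)
  have holh: "h holomorphic_on ball 0 1" by (rule H2_holomorphic[OF h])
  have hol: "(\<lambda>z. f z * h z) holomorphic_on ball 0 1" by (intro holomorphic_intros holf holh)
  obtain C where C: "\<forall>r\<in>{0..<1::real}. (LINT \<zeta>|circle_measure. (cmod (h (of_real r * \<zeta>)))\<^sup>2) \<le> C"
    using h by (auto simp: H2_def)
  have "(LINT \<zeta>|circle_measure. (cmod (f (of_real r * \<zeta>) * h (of_real r * \<zeta>)))\<^sup>2) \<le> B\<^sup>2 * C" if r: "r \<in> {0..<1}" for r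
  proof -
    have "(LINT \<zeta>|circle_measure. (cmod (f (of_real r * \<zeta>) * h (of_real r * \<zeta>)))\<^sup>2)
        \<le> (LINT \<zeta>|circle_measure. B\<^sup>2 * (cmod (h (of_real r * \<zeta>)))\<^sup>2)"
    proof (rule integral_mono)
      show "integrable circle_measure (\<lambda>\<zeta>. (cmod (f (of_real r * \<zeta>) * h (of_real r * \<zeta>)))\<^sup>2)"
        by (rule L2_integrable_square[OF dilation_L2[OF hol]]) (use r in auto)
      show "integrable circle_measure (\<lambda>\<zeta>. B\<^sup>2 * (cmod (h (of_real r * \<zeta>)))\<^sup>2)"
        by (rule integrable_mult_right, rule L2_integrable_square[OF dilation_L2[OF holh]]) (use r in auto)
      fix \<zeta> assume "\<zeta> \<in> space circle_measure"
      then have "of_real r * \<zeta> \<in> ball 0 1" using r by (simp add: norm_mult)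
      then have "cmod (f (of_real r * \<zeta>)) \<le> B" using B by blast
      then show "(cmod (f (of_real r * \<zeta>) * h (of_real r * \<zeta>)))\<^sup>2 \<le> B\<^sup>2 * (cmod (h (of_real r * \<zeta>)))\<^sup>2"
        by (auto simp: norm_mult power_mult_distrib intro!: mult_right_mono power_mono)
    qed
    also have "\<dots> \<le> B\<^sup>2 * C" using C r by (auto intro!: mult_left_mono)
    finally show ?thesis .
  qed
  moreover have "\<forall>z. z \<notin> ball 0 1 \<longrightarrow> f z * h z = 0" using H2_zero_outside[OF h] by auto
  ultimately show ?thesis unfolding H2_def using hol by blast
qed

text \<open>
  Multiply with the constant 1, which in the disc convention is the monomial of degree 0.
\<close>
lemma Hinf_H2:
  assumes f: "f \<in> Hinf" shows "f \<in> H2"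
proof -
  have "(\<lambda>z. f z * (if z \<in> ball 0 1 then z ^ 0 else 0)) \<in> H2" by (intro Hinf_times_H2 f disc_monomial)
  moreover have "(\<lambda>z. f z * (if z \<in> ball 0 1 then z ^ 0 else 0)) = f" using f by (auto simp: Hinf_def)
  ultimately show ?thesis by simp
qed

lemma boundary_Linf:
  assumes f: "f \<in> Hinf" shows "boundary f \<in> Linf_circle"
proof -
  have "bounded (f ` ball 0 1)" using f by (auto simp: Hinf_def)
  then obtain B where B: "\<forall>z\<in>ball 0 1. cmod (f z) \<le> B" by (auto simp: bounded_iff)
  have "AE \<zeta> in circle_measure. cmod (boundary f \<zeta>) \<le> B"
    using H2_tendsto_boundary_AE[OF Hinf_H2[OF f]] AE_circle
  proof eventually_elim
    case (elim \<zeta>)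
    have "eventually (\<lambda>r. cmod (f (of_real r * \<zeta>)) \<le> B) (at_left (1::real))"
      using eventually_unit_interval_at_left_1
      by eventually_elim (use elim B in \<open>auto simp: norm_mult\<close>)
    with tendsto_norm[OF elim(1)] show ?case by (rule tendsto_upperbound) simp
  qed
  then show ?thesis using boundary_measurable f by (auto simp: Linf_circle_def Hinf_def)
qed

lemma cnj_Linf: "b \<in> Linf_circle \<Longrightarrow> (\<lambda>\<zeta>. cnj (b \<zeta>)) \<in> Linf_circle"
  by (auto simp: Linf_circle_def intro!: measurable_compose[of b circle_measure borel cnj] borel_measurable_continuous_onI continuous_intros)

lemma boundary_mult_AE:
  assumes f: "f \<in> Hinf" and h: "h \<in> H2"
  shows "AE \<zeta> in circle_measure. boundary (\<lambda>z. f z * h z) \<zeta> = boundary f \<zeta> * boundary h \<zeta>"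
  using H2_tendsto_boundary_AE[OF Hinf_H2[OF f]] H2_tendsto_boundary_AE[OF h]
  by eventually_elim (intro boundary_eqI tendsto_mult)

lemma boundary_add_AE:
  assumes "f \<in> H2" "h \<in> H2"
  shows "AE \<zeta> in circle_measure. boundary (f + h) \<zeta> = boundary f \<zeta> + boundary h \<zeta>"
  using assms[THEN H2_tendsto_boundary_AE]
  by eventually_elim (unfold plus_fun_def, intro boundary_eqI tendsto_add)

lemma boundary_scale_AE:
  assumes "f \<in> H2"
  shows "AE \<zeta> in circle_measure. boundary (cfun_scale c f) \<zeta> = c * boundary f \<zeta>"
  using assms[THEN H2_tendsto_boundary_AE]
  by eventually_elim (unfold cfun_scale_def, intro boundary_eqI tendsto_mult tendsto_const)

lemma H2_add:
  assumes "f \<in> H2" "h \<in> H2" shows "f + h \<in> H2"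
proof -
  obtain a where a: "has_powser a f" "summable (\<lambda>n. (cmod (a n))\<^sup>2)" using H2_powser[OF assms(1)] .
  obtain b where b: "has_powser b h" "summable (\<lambda>n. (cmod (b n))\<^sup>2)" using H2_powser[OF assms(2)] .
  show ?thesis
  proof (rule H2I_powser)
    show "has_powser (\<lambda>n. a n + b n) (f + h)"
      using a b unfolding has_powser_def by (auto simp: distrib_right intro!: sums_add)
    show "summable (\<lambda>n. (cmod (a n + b n))\<^sup>2)"
    proof (rule summable_comparison_test')
      show "summable (\<lambda>n. 2 * (cmod (a n))\<^sup>2 + 2 * (cmod (b n))\<^sup>2)" using a b by (intro summable_add summable_mult)
      fix n
      have "(cmod (a n + b n))\<^sup>2 \<le> (cmod (a n) + cmod (b n))\<^sup>2" by (intro power_mono norm_triangle_ineq) auto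
      also have "\<dots> \<le> 2 * (cmod (a n))\<^sup>2 + 2 * (cmod (b n))\<^sup>2"
        using sum_squares_bound[of "cmod (a n)" "cmod (b n)"] by (simp add: power2_sum)
      finally show "norm ((cmod (a n + b n))\<^sup>2) \<le> 2 * (cmod (a n))\<^sup>2 + 2 * (cmod (b n))\<^sup>2" by simp
    qed
  qed (use H2_zero_outside[OF assms(1)] H2_zero_outside[OF assms(2)] in auto)
qed

lemma H2_scale:
  assumes "f \<in> H2" shows "cfun_scale c f \<in> H2"
proof -
  obtain a where a: "has_powser a f" "summable (\<lambda>n. (cmod (a n))\<^sup>2)" using H2_powser[OF assms(1)] .
  show ?thesis
  proof (rule H2I_powser)
    show "has_powser (\<lambda>n. c * a n) (cfun_scale c f)"
      using a unfolding has_powser_def cfun_scale_def by (auto simp: mult.assoc intro!: sums_mult)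
    show "summable (\<lambda>n. (cmod (c * a n))\<^sup>2)" using a by (simp add: norm_mult power_mult_distrib summable_mult)
  qed (use H2_zero_outside[OF assms(1)] in \<open>auto simp: cfun_scale_def\<close>)
qed

lemma H2_zero: "0 \<in> H2"
  by (rule H2I_powser[of "\<lambda>_. 0"]) (auto simp: has_powser_def)

lemma H2_subspace: "cfun.subspace H2"
  by (auto simp: cfun.subspace_def H2_zero H2_add H2_scale)

section \<open>Toeplitz operators\<close>

lemma Toeplitz_L2: "g \<in> Linf_circle \<Longrightarrow> f \<in> H2 \<Longrightarrow> (\<lambda>\<zeta>. g \<zeta> * boundary f \<zeta>) \<in> L2_circle"
  by (intro L2_mult_bounded boundary_L2)

lemma Toeplitz_H2: "g \<in> Linf_circle \<Longrightarrow> f \<in> H2 \<Longrightarrow> Toeplitz g f \<in> H2"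
  unfolding Toeplitz_def by (intro H2_proj_props Toeplitz_L2)

lemma Toeplitz_orth:
  "g \<in> Linf_circle \<Longrightarrow> f \<in> H2 \<Longrightarrow> H2_orth (\<lambda>\<zeta>. g \<zeta> * boundary f \<zeta> - boundary (Toeplitz g f) \<zeta>)"
  unfolding Toeplitz_def by (intro H2_proj_props Toeplitz_L2)

lemma boundary_borel: "f \<in> H2 \<Longrightarrow> boundary f \<in> borel_measurable circle_measure"
  by (intro boundary_measurable H2_holomorphic)

text \<open>
  The form in which the projection is used below: the error is exhibited as a function already
  known to be orthogonal to \<open>H2\<close>, up to a null set.
\<close>
lemma Toeplitz_eqI:
  assumes g: "g \<in> Linf_circle" and f: "f \<in> H2" and h: "h \<in> H2" and \<phi>: "H2_orth \<phi>"
    and eq: "AE \<zeta> in circle_measure. \<phi> \<zeta> = g \<zeta> * boundary f \<zeta> - boundary h \<zeta>"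
  shows "Toeplitz g f = h"
  unfolding Toeplitz_def
proof (rule H2_proj_eqI[OF Toeplitz_L2[OF g f] h])
  have [measurable]: "g \<in> borel_measurable circle_measure" using g by (simp add: Linf_circle_def)
  note [measurable] = boundary_borel[OF f] boundary_borel[OF h]
  show "H2_orth (\<lambda>\<zeta>. g \<zeta> * boundary f \<zeta> - boundary h \<zeta>)"
    by (rule H2_orth_cong_AE[OF \<phi> _ eq]) measurable
qed

lemma Toeplitz_add:
  assumes g: "g \<in> Linf_circle" and f: "f \<in> H2" and h: "h \<in> H2"
  shows "Toeplitz g (f + h) = Toeplitz g f + Toeplitz g h"
proof (rule Toeplitz_eqI[OF g H2_add[OF f h] H2_add[OF Toeplitz_H2[OF g f] Toeplitz_H2[OF g h]]])
  show "H2_orth (\<lambda>\<zeta>. (g \<zeta> * boundary f \<zeta> - boundary (Toeplitz g f) \<zeta>) + (g \<zeta> * boundary h \<zeta> - boundary (Toeplitz g h) \<zeta>))"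
    by (intro H2_orth_add Toeplitz_orth g f h)
  show "AE \<zeta> in circle_measure. (g \<zeta> * boundary f \<zeta> - boundary (Toeplitz g f) \<zeta>) + (g \<zeta> * boundary h \<zeta> - boundary (Toeplitz g h) \<zeta>)
      = g \<zeta> * boundary (f + h) \<zeta> - boundary (Toeplitz g f + Toeplitz g h) \<zeta>"
    using boundary_add_AE[OF f h] boundary_add_AE[OF Toeplitz_H2[OF g f] Toeplitz_H2[OF g h]]
    by eventually_elim (simp add: algebra_simps)
qed

lemma Toeplitz_scale:
  assumes g: "g \<in> Linf_circle" and f: "f \<in> H2"
  shows "Toeplitz g (cfun_scale c f) = cfun_scale c (Toeplitz g f)"
proof (rule Toeplitz_eqI[OF g H2_scale[OF f] H2_scale[OF Toeplitz_H2[OF g f]]])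
  show "H2_orth (\<lambda>\<zeta>. c * (g \<zeta> * boundary f \<zeta> - boundary (Toeplitz g f) \<zeta>))"
    by (intro H2_orth_scale Toeplitz_orth g f)
  show "AE \<zeta> in circle_measure. c * (g \<zeta> * boundary f \<zeta> - boundary (Toeplitz g f) \<zeta>)
      = g \<zeta> * boundary (cfun_scale c f) \<zeta> - boundary (cfun_scale c (Toeplitz g f)) \<zeta>"
    using boundary_scale_AE[OF f, of c] boundary_scale_AE[OF Toeplitz_H2[OF g f], of c]
    by eventually_elim (simp add: algebra_simps)
qed

text \<open>
  The conjugate factor moves to the other side as multiplication by \<open>b\<close>, and that preserves \<open>H2\<close>.
\<close>
lemma H2_orth_mult_cnj:
  assumes \<phi>: "H2_orth \<phi>" and b: "b \<in> Hinf"
  shows "H2_orth (\<lambda>\<zeta>. cnj (boundary b \<zeta>) * \<phi> \<zeta>)"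
  unfolding H2_orth_def
proof (intro conjI ballI)
  have \<phi>L2: "\<phi> \<in> L2_circle" using \<phi> by (simp add: H2_orth_def)
  then show L2: "(\<lambda>\<zeta>. cnj (boundary b \<zeta>) * \<phi> \<zeta>) \<in> L2_circle"
    by (intro L2_mult_bounded cnj_Linf boundary_Linf b)
  fix k assume k: "k \<in> H2"
  have "L2_inner (\<lambda>\<zeta>. cnj (boundary b \<zeta>) * \<phi> \<zeta>) (boundary k) = L2_inner \<phi> (boundary (\<lambda>z. b z * k z))"
  proof (rule L2_inner_cong_AE)
    show "AE \<zeta> in circle_measure. cnj (boundary b \<zeta>) * \<phi> \<zeta> * cnj (boundary k \<zeta>) = \<phi> \<zeta> * cnj (boundary (\<lambda>z. b z * k z) \<zeta>)"
      using boundary_mult_AE[OF b k] by eventually_elim simp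
  qed (intro L2 \<phi>L2 boundary_L2 k Hinf_times_H2 b)+
  then show "L2_inner (\<lambda>\<zeta>. cnj (boundary b \<zeta>) * \<phi> \<zeta>) (boundary k) = 0"
    using \<phi> Hinf_times_H2[OF b k] by (simp add: H2_orth_def)
qed

lemma Hinf_inverse:
  assumes "Hinf_invertible f"
  shows "(\<lambda>z. inverse (f z)) \<in> Hinf" and "\<And>z. z \<in> ball 0 1 \<Longrightarrow> f z \<noteq> 0"
proof -
  obtain k where f: "f \<in> Hinf" and k: "k \<in> Hinf" "\<And>z. z \<in> ball 0 1 \<Longrightarrow> f z * k z = 1"
    using assms by (auto simp: Hinf_invertible_def)
  have "inverse (f z) = k z" for z
  proof (cases "z \<in> ball 0 1")
    case True
    then show ?thesis using k(2) by (metis inverse_unique)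
  next
    case False
    then show ?thesis using f k by (auto simp: Hinf_def)
  qed
  then have "(\<lambda>z. inverse (f z)) = k" by auto
  with k show "(\<lambda>z. inverse (f z)) \<in> Hinf" by simp
  show "f z \<noteq> 0" if "z \<in> ball 0 1" for z using k(2)[OF that] by auto
qed

lemma boundary_inverse_AE:
  assumes inv: "Hinf_invertible f"
  shows "AE \<zeta> in circle_measure. boundary f \<zeta> * boundary (\<lambda>z. inverse (f z)) \<zeta> = 1"
proof -
  have f: "f \<in> Hinf" using inv by (simp add: Hinf_invertible_def)
  have "(\<lambda>z. f z * inverse (f z)) = (\<lambda>z. if z \<in> ball 0 1 then z ^ 0 else 0)"
    using Hinf_inverse(2)[OF inv] f by (auto simp: Hinf_def)
  then have "boundary (\<lambda>z. f z * inverse (f z)) \<zeta> = 1" if "\<zeta> \<in> sphere 0 1" for \<zeta>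
    using disc_monomial(2)[OF that, of 0] by simp
  with boundary_mult_AE[OF f Hinf_H2[OF Hinf_inverse(1)[OF inv]]] AE_circle
  show ?thesis by (auto elim: eventually_elim2)
qed

lemma inverse_cnj_boundary:
  assumes inv: "Hinf_invertible f"
  shows "AE \<zeta> in circle_measure. cnj (boundary (\<lambda>z. inverse (f z)) \<zeta>) = inverse (cnj (boundary f \<zeta>))"
    and "(\<lambda>\<zeta>. inverse (cnj (boundary f \<zeta>))) \<in> Linf_circle"
proof -
  have f: "f \<in> Hinf" using inv by (simp add: Hinf_invertible_def)
  show eq: "AE \<zeta> in circle_measure. cnj (boundary (\<lambda>z. inverse (f z)) \<zeta>) = inverse (cnj (boundary f \<zeta>))"
    using boundary_inverse_AE[OF inv] by eventually_elim (metis complex_cnj_inverse inverse_unique)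
  have "(\<lambda>\<zeta>. inverse (cnj (boundary f \<zeta>))) \<in> borel_measurable circle_measure"
    using cnj_Linf[OF boundary_Linf[OF f]] by (intro borel_measurable_inverse) (simp add: Linf_circle_def)
  moreover obtain C where C: "AE \<zeta> in circle_measure. cmod (cnj (boundary (\<lambda>z. inverse (f z)) \<zeta>)) \<le> C"
    using cnj_Linf[OF boundary_Linf[OF Hinf_inverse(1)[OF inv]]] unfolding Linf_circle_def by blast
  have "AE \<zeta> in circle_measure. cmod (inverse (cnj (boundary f \<zeta>))) \<le> C"
    using C eq by eventually_elim simp
  ultimately show "(\<lambda>\<zeta>. inverse (cnj (boundary f \<zeta>))) \<in> Linf_circle" unfolding Linf_circle_def by blast
qed

section \<open>The backward shift\<close>

text \<open>
  With \<open>q\<close> the shifted power series, \<open>f z = a 0 + z q z\<close>. Differentiating at 0 identifies the value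
  \<open>deriv f 0\<close> of the shift at the origin with \<open>q 0\<close>.
\<close>
lemma backward_shift_powser:
  assumes a: "has_powser a f"
  shows "has_powser (\<lambda>n. a (Suc n)) (backward_shift f)"
proof -
  define q where "q z = (\<Sum>n. a (Suc n) * z ^ n)" for z
  have summ: "summable (\<lambda>n. a n * z ^ n)" and fz: "f z = (\<Sum>n. a n * z ^ n)" if "z \<in> ball 0 1" for z
    using a that by (auto simp: has_powser_def sums_iff)
  have q: "has_powser (\<lambda>n. a (Suc n)) q"
    unfolding has_powser_def q_def using summ by (auto simp: summable_powser_split_head intro!: summable_sums)
  have f: "f z = a 0 + q z * z" if "z \<in> ball 0 1" for z
    using powser_split_head(1)[OF summ[OF that]] fz[OF that] by (simp add: q_def)
  have f0: "f 0 = a 0" using f[of 0] by simp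
  have "q field_differentiable at 0"
    by (rule holomorphic_on_imp_differentiable_at[OF has_powser_holomorphic[OF q]]) auto
  then obtain q' where q': "(q has_field_derivative q') (at 0)" by (auto simp: field_differentiable_def)
  have "((\<lambda>z. a 0 + q z * z) has_field_derivative q 0) (at 0)"
    by (rule derivative_eq_intros q' refl)+ simp
  then have "(f has_field_derivative q 0) (at 0)"
    by (rule has_field_derivative_transform_within_open[of _ _ _ "ball 0 1"]) (auto simp: f)
  then have "deriv f 0 = q 0" by (rule DERIV_imp_deriv)
  then have "backward_shift f z = q z" if "z \<in> ball 0 1" for z
    using f[OF that] f0 that by (auto simp: backward_shift_def)
  then show ?thesis using q by (simp add: has_powser_def)
qed

lemma backward_shift_H2:
  assumes "f \<in> H2" shows "backward_shift f \<in> H2"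
proof -
  obtain a where a: "has_powser a f" "summable (\<lambda>n. (cmod (a n))\<^sup>2)" using H2_powser[OF assms] .
  show ?thesis
    by (rule H2I_powser[OF backward_shift_powser[OF a(1)]])
       (use a(2) in \<open>auto simp: backward_shift_def summable_Suc_iff[of "\<lambda>n. (cmod (a n))\<^sup>2"]\<close>)
qed

lemma backward_shift_add:
  assumes "f \<in> H2" "h \<in> H2"
  shows "backward_shift (f + h) = backward_shift f + backward_shift h"
proof -
  have "f field_differentiable at 0" "h field_differentiable at 0"
    by (rule holomorphic_on_imp_differentiable_at[OF assms(1)[THEN H2_holomorphic]]
             holomorphic_on_imp_differentiable_at[OF assms(2)[THEN H2_holomorphic]]; simp)+
  then have "deriv (\<lambda>z. f z + h z) 0 = deriv f 0 + deriv h 0" by (rule deriv_add)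
  then show ?thesis by (auto simp: backward_shift_def fun_eq_iff plus_fun_def add_divide_distrib diff_divide_distrib)
qed

lemma backward_shift_scale:
  assumes "f \<in> H2"
  shows "backward_shift (cfun_scale c f) = cfun_scale c (backward_shift f)"
proof -
  have "f field_differentiable at 0"
    by (rule holomorphic_on_imp_differentiable_at[OF assms(1)[THEN H2_holomorphic]]) simp_all
  then have "deriv (\<lambda>z. c * f z) 0 = c * deriv f 0" by (rule deriv_cmult)
  then show ?thesis by (auto simp: backward_shift_def fun_eq_iff cfun_scale_def right_diff_distrib)
qed

lemma cnj_circle: "\<zeta> \<in> sphere 0 1 \<Longrightarrow> inverse \<zeta> = cnj \<zeta>"
  using complex_norm_square[of \<zeta>] by (auto simp: inverse_unique)

lemma boundary_backward_shift_AE: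
  assumes f: "f \<in> H2"
  shows "AE \<zeta> in circle_measure. boundary (backward_shift f) \<zeta> = cnj \<zeta> * (boundary f \<zeta> - f 0)"
  using H2_tendsto_boundary_AE[OF f] AE_circle
proof eventually_elim
  case (elim \<zeta>)
  have nz: "\<zeta> \<noteq> 0" using elim by auto
  show ?case
  proof (rule boundary_eqI, rule Lim_transform_eventually)
    have "((\<lambda>r. (f (of_real r * \<zeta>) - f 0) / (of_real r * \<zeta>)) \<longlongrightarrow> (boundary f \<zeta> - f 0) / (of_real 1 * \<zeta>)) (at_left (1::real))"
      by (intro tendsto_intros elim) (use nz in auto)
    then show "((\<lambda>r. (f (of_real r * \<zeta>) - f 0) / (of_real r * \<zeta>)) \<longlongrightarrow> cnj \<zeta> * (boundary f \<zeta> - f 0)) (at_left (1::real))"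
      using cnj_circle[OF elim(2)] by (simp add: divide_inverse mult.commute)
    have "eventually (\<lambda>r. r \<in> {0<..<1}) (at_left (1::real))" by (rule eventually_at_leftI[of 0]) auto
    then show "eventually (\<lambda>r. (f (of_real r * \<zeta>) - f 0) / (of_real r * \<zeta>) = backward_shift f (of_real r * \<zeta>)) (at_left (1::real))"
      by eventually_elim (use nz elim(2) in \<open>auto simp: backward_shift_def norm_mult\<close>)
  qed
qed

text \<open>
  The coordinate function as an element of \<^const>\<open>Hinf\<close>.
\<close>
definition disc_id :: "complex \<Rightarrow> complex" where "disc_id z = (if z \<in> ball 0 1 then z else 0)"

lemma disc_id: "disc_id \<in> Hinf" "\<zeta> \<in> sphere 0 1 \<Longrightarrow> boundary disc_id \<zeta> = \<zeta>"
proof -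
  have m: "disc_id = (\<lambda>z. if z \<in> ball 0 1 then z ^ 1 else 0)" by (simp add: disc_id_def fun_eq_iff)
  show "\<zeta> \<in> sphere 0 1 \<Longrightarrow> boundary disc_id \<zeta> = \<zeta>"
    using disc_monomial(2)[of \<zeta> 1] unfolding m by simp
  have "disc_id \<in> H2" unfolding m by (rule disc_monomial)
  moreover have "bounded (disc_id ` ball 0 1)" unfolding bounded_iff by (auto simp: disc_id_def intro!: exI[of _ 1])
  ultimately show "disc_id \<in> Hinf" by (auto simp: Hinf_def H2_def)
qed

lemma H2_orth_cnj_id: "H2_orth cnj"
proof (rule H2_orthI_monomials)
  show "cnj \<in> L2_circle" by (intro continuous_L2 continuous_intros)
  fix n
  have "L2_inner cnj (\<lambda>\<zeta>. \<zeta> ^ n) = L2_inner (\<lambda>\<zeta>. \<zeta> ^ 0) (\<lambda>\<zeta>. \<zeta> ^ Suc n)"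
    unfolding L2_inner_def by simp
  then show "L2_inner cnj (\<lambda>\<zeta>. \<zeta> ^ n) = 0" by (simp only: L2_inner_monomials) simp
qed

text \<open>
  On the circle both shifts are multiplication by \<open>cnj \<zeta>\<close>, up to the constant \<open>p 0\<close> for
  \<open>p = T g h\<close>. So the error of the claimed projection is \<open>cnj \<zeta>\<close> times the error
  \<open>g h - p\<close>, which remains orthogonal to \<open>H2\<close>, plus \<open>p 0 \<cdot> cnj \<zeta>\<close>, which is orthogonal as well.
\<close>
lemma Toeplitz_backward_shift:
  assumes g: "g \<in> Linf_circle" and h: "h \<in> H2" and h0: "h 0 = 0"
  shows "Toeplitz g (backward_shift h) = backward_shift (Toeplitz g h)"
proof (rule Toeplitz_eqI[OF g])
  define p where "p = Toeplitz g h"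
  have p: "p \<in> H2" unfolding p_def by (rule Toeplitz_H2[OF g h])
  show "backward_shift h \<in> H2" "backward_shift (Toeplitz g h) \<in> H2"
    by (intro backward_shift_H2 h Toeplitz_H2 g)+
  show "H2_orth (\<lambda>\<zeta>. cnj (boundary disc_id \<zeta>) * (g \<zeta> * boundary h \<zeta> - boundary p \<zeta>) + p 0 * cnj \<zeta>)"
    unfolding p_def
    by (intro H2_orth_add H2_orth_mult_cnj disc_id Toeplitz_orth g h H2_orth_scale H2_orth_cnj_id)
  show "AE \<zeta> in circle_measure. cnj (boundary disc_id \<zeta>) * (g \<zeta> * boundary h \<zeta> - boundary p \<zeta>) + p 0 * cnj \<zeta>
      = g \<zeta> * boundary (backward_shift h) \<zeta> - boundary (backward_shift (Toeplitz g h)) \<zeta>"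
    using boundary_backward_shift_AE[OF h] boundary_backward_shift_AE[OF p] AE_circle
    unfolding p_def[symmetric]
    by eventually_elim (simp add: disc_id h0 algebra_simps)
qed

section \<open>The kernel of the perturbed operator\<close>

text \<open>
  Put \<open>p = T g s\<close> and \<open>e = f1 \<cdot> s\<close>. With \<open>k2 = 1/f2\<close> one has \<open>cnj k2 \<cdot> g \<cdot> s = e\<close> on the circle, so
  \<open>cnj k2 \<cdot> p - e\<close> is minus \<open>cnj k2\<close> times the error \<open>g \<cdot> s - p\<close>, hence orthogonal to \<open>H2\<close>: the inner
  operator maps \<open>p\<close> to \<open>e\<close>. Dividing the analytic function \<open>e\<close> by \<open>f1\<close> involves no projection.
\<close>
lemma Toeplitz_left_inverse:
  assumes f1: "Hinf_invertible f1" and f2: "Hinf_invertible f2" and g: "g \<in> Linf_circle"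
    and geq: "AE \<zeta> in circle_measure. g \<zeta> = boundary f1 \<zeta> * cnj (boundary f2 \<zeta>)"
    and s: "s \<in> H2"
  shows "Toeplitz (boundary (\<lambda>z. inverse (f1 z)))
           (Toeplitz (\<lambda>\<zeta>. inverse (cnj (boundary f2 \<zeta>))) (Toeplitz g s)) = s"
proof -
  define k1 where "k1 = (\<lambda>z. inverse (f1 z))"
  define k2 where "k2 = (\<lambda>z. inverse (f2 z))"
  have k: "k1 \<in> Hinf" "k2 \<in> Hinf" unfolding k1_def k2_def by (intro Hinf_inverse f1 f2)+
  have f: "f1 \<in> Hinf" "f2 \<in> Hinf" using f1 f2 by (auto simp: Hinf_invertible_def)
  define e where "e = (\<lambda>z. f1 z * s z)"
  have e: "e \<in> H2" unfolding e_def by (rule Hinf_times_H2[OF f(1) s])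
  have e_AE: "AE \<zeta> in circle_measure. boundary e \<zeta> = boundary f1 \<zeta> * boundary s \<zeta>"
    unfolding e_def by (rule boundary_mult_AE[OF f(1) s])
  have k1_AE: "AE \<zeta> in circle_measure. boundary f1 \<zeta> * boundary k1 \<zeta> = 1"
    unfolding k1_def by (rule boundary_inverse_AE[OF f1])
  have k2_AE: "AE \<zeta> in circle_measure. boundary f2 \<zeta> * boundary k2 \<zeta> = 1"
    unfolding k2_def by (rule boundary_inverse_AE[OF f2])
  have i_AE: "AE \<zeta> in circle_measure. cnj (boundary k2 \<zeta>) = inverse (cnj (boundary f2 \<zeta>))"
    unfolding k2_def by (rule inverse_cnj_boundary(1)[OF f2])
  have iL: "(\<lambda>\<zeta>. inverse (cnj (boundary f2 \<zeta>))) \<in> Linf_circle"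
    by (rule inverse_cnj_boundary(2)[OF f2])
  define p where "p = Toeplitz g s"
  have p: "p \<in> H2" unfolding p_def by (rule Toeplitz_H2[OF g s])
  have "Toeplitz (\<lambda>\<zeta>. inverse (cnj (boundary f2 \<zeta>))) p = e"
  proof (rule Toeplitz_eqI[OF iL p e])
    show "H2_orth (\<lambda>\<zeta>. (- 1) * (cnj (boundary k2 \<zeta>) * (g \<zeta> * boundary s \<zeta> - boundary p \<zeta>)))"
      unfolding p_def by (intro H2_orth_scale H2_orth_mult_cnj k Toeplitz_orth g s)
    show "AE \<zeta> in circle_measure. (- 1) * (cnj (boundary k2 \<zeta>) * (g \<zeta> * boundary s \<zeta> - boundary p \<zeta>))
        = inverse (cnj (boundary f2 \<zeta>)) * boundary p \<zeta> - boundary e \<zeta>"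
      using geq i_AE k2_AE e_AE
    proof eventually_elim
      case (elim \<zeta>)
      have "cnj (boundary k2 \<zeta>) * g \<zeta> = boundary f1 \<zeta> * cnj (boundary f2 \<zeta> * boundary k2 \<zeta>)"
        using elim(1) by (simp add: mult_ac)
      then have "cnj (boundary k2 \<zeta>) * g \<zeta> = boundary f1 \<zeta>" using elim(3) by simp
      then have "cnj (boundary k2 \<zeta>) * (g \<zeta> * boundary s \<zeta>) = boundary e \<zeta>"
        using elim(4) by (simp add: mult.assoc[symmetric])
      then show ?case using elim(2) by (simp add: right_diff_distrib)
    qed
  qed
  moreover have "Toeplitz (boundary k1) e = s"
  proof (rule Toeplitz_eqI[OF boundary_Linf[OF k(1)] e s])
    show "H2_orth (\<lambda>\<zeta>. 0 * cnj \<zeta>)" by (intro H2_orth_scale H2_orth_cnj_id)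
    show "AE \<zeta> in circle_measure. 0 * cnj \<zeta> = boundary k1 \<zeta> * boundary e \<zeta> - boundary s \<zeta>"
      using e_AE k1_AE by eventually_elim (simp add: mult.assoc[symmetric] mult.commute[of "boundary k1 _"])
  qed
  ultimately show ?thesis unfolding p_def k1_def by simp
qed

lemma H2_inner_add_left: "f \<in> H2 \<Longrightarrow> h \<in> H2 \<Longrightarrow> k \<in> H2 \<Longrightarrow> H2_inner (f + h) k = H2_inner f k + H2_inner h k"
  unfolding H2_inner_def
  by (subst L2_inner_add_left[symmetric], (intro boundary_L2; assumption)+, rule L2_inner_cong_AE)
     (use boundary_add_AE[of f h] in \<open>auto elim: eventually_mono intro: L2_add boundary_L2 H2_add\<close>)

lemma H2_inner_scale_left: "f \<in> H2 \<Longrightarrow> k \<in> H2 \<Longrightarrow> H2_inner (cfun_scale c f) k = c * H2_inner f k"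
  unfolding H2_inner_def
  by (subst L2_inner_scale_left[symmetric], rule L2_inner_cong_AE)
     (use boundary_scale_AE[of f c] in \<open>auto elim: eventually_mono intro: L2_scale boundary_L2 H2_scale\<close>)

lemma perturbed_Toeplitz_kernel_subspace:
  assumes g: "g \<in> Linf_circle" and u: "\<And>i. i \<in> {1..n} \<Longrightarrow> u i \<in> H2"
  shows "cfun.subspace (H2_kernel (perturbed_Toeplitz g n u v))"
proof -
  let ?R = "perturbed_Toeplitz g n u v"
  have add: "?R (f + h) = ?R f + ?R h" if "f \<in> H2" "h \<in> H2" for f h
    using that u by (simp add: perturbed_Toeplitz_def Toeplitz_add[OF g] H2_inner_add_left
        cfun.scale_left_distrib sum.distrib algebra_simps)
  have scale: "?R (cfun_scale c f) = cfun_scale c (?R f)" if "f \<in> H2" for c f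
    using that u by (simp add: perturbed_Toeplitz_def Toeplitz_scale[OF g] H2_inner_scale_left
        cfun.scale_right_distrib cfun.scale_sum_right)
  have zero: "?R 0 = 0"
    using scale[OF H2_zero, of 0] by simp
  show ?thesis
    by (auto simp: cfun.subspace_def H2_kernel_def H2_zero H2_add H2_scale zero add scale)
qed

theorem theorem2p5:
  fixes n :: nat
    and u v :: "nat \<Rightarrow> complex \<Rightarrow> complex"
    and g f1 f2 :: "complex \<Rightarrow> complex"
  assumes "n \<ge> 1"
    and "\<And>i. i \<in> {1..n} \<Longrightarrow> u i \<in> H2"
    and "\<And>i j. i \<in> {1..n} \<Longrightarrow> j \<in> {1..n} \<Longrightarrow>
           H2_inner (u i) (u j) = (if i = j then 1 else 0)"
    and "\<And>i. i \<in> {1..n} \<Longrightarrow> v i \<in> H2"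
    and "\<And>i. i \<in> {1..n} \<Longrightarrow> v i \<noteq> 0"
    and "\<And>i j. i \<in> {1..n} \<Longrightarrow> j \<in> {1..n} \<Longrightarrow> i \<noteq> j \<Longrightarrow> H2_inner (v i) (v j) = 0"
    and "Hinf_invertible f1"
    and "Hinf_invertible f2"
    and "g \<in> Linf_circle"
    and "AE \<zeta> in circle_measure. g \<zeta> = boundary f1 \<zeta> * cnj (boundary f2 \<zeta>)"
  shows "nearly_invariant_defect_le
           (H2_kernel (perturbed_Toeplitz g n u v)) n
           (cfun.span ((\<lambda>i. Toeplitz (boundary (\<lambda>z. inverse (f1 z)))
                              (Toeplitz (\<lambda>\<zeta>. inverse (cnj (boundary f2 \<zeta>)))
                                (backward_shift (v i)))) ` {1..n}))"
proof -
  note u = assms(2) and v = assms(4) and f1 = assms(7) and f2 = assms(8) and g = assms(9) and geq = assms(10)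
  define L where "L w = Toeplitz (boundary (\<lambda>z. inverse (f1 z)))
      (Toeplitz (\<lambda>\<zeta>. inverse (cnj (boundary f2 \<zeta>))) (backward_shift w))" for w
  define B where "B = (\<lambda>i. L (v i)) ` {1..n}"
  define M where "M = H2_kernel (perturbed_Toeplitz g n u v)"
  have i1: "boundary (\<lambda>z. inverse (f1 z)) \<in> Linf_circle" by (intro boundary_Linf Hinf_inverse f1)
  have i2: "(\<lambda>\<zeta>. inverse (cnj (boundary f2 \<zeta>))) \<in> Linf_circle" by (rule inverse_cnj_boundary(2)[OF f2])
  have L_H2: "L w \<in> H2" if "w \<in> H2" for w
    unfolding L_def by (intro Toeplitz_H2 i1 i2 backward_shift_H2 that)
  have L_add: "L (w + w') = L w + L w'" if "w \<in> H2" "w' \<in> H2" for w w'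
    using that by (simp add: L_def backward_shift_add Toeplitz_add i1 i2 Toeplitz_H2 backward_shift_H2)
  have L_scale: "L (cfun_scale c w) = cfun_scale c (L w)" if "w \<in> H2" for c w
    using that by (simp add: L_def backward_shift_scale Toeplitz_scale i1 i2 Toeplitz_H2 backward_shift_H2)
  have B_H2: "B \<subseteq> H2" unfolding B_def using v L_H2 by auto
  have M: "cfun.subspace M" unfolding M_def by (rule perturbed_Toeplitz_kernel_subspace[OF g u])
  \<comment> \<open>All vectors whose image lies in the defect space form a subspace; it contains the \<open>v i\<close>, hence \<open>T g h\<close>.\<close>
  have preimage: "cfun.subspace {w \<in> H2. L w \<in> cfun.span B}"
  proof -
    have "L 0 = 0" using L_scale[OF H2_zero, of 0] by simp
    then show ?thesis
      by (auto simp: cfun.subspace_def H2_zero H2_add H2_scale L_add L_scale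
            intro: cfun.span_zero cfun.span_add cfun.span_scale)
  qed
  have shift: "backward_shift h \<in> cfun.span B" if h: "h \<in> M" and h0: "h 0 = 0" for h
  proof -
    have hH: "h \<in> H2" and R0: "perturbed_Toeplitz g n u v h = 0" using h by (auto simp: M_def H2_kernel_def)
    have "Toeplitz g h = - (\<Sum>i\<in>{1..n}. cfun_scale (H2_inner h (u i)) (v i))"
      using R0 unfolding perturbed_Toeplitz_def by (simp add: eq_neg_iff_add_eq_0)
    moreover have "v i \<in> {w \<in> H2. L w \<in> cfun.span B}" if "i \<in> {1..n}" for i
      using that v by (auto simp: B_def intro: cfun.span_base)
    ultimately have "Toeplitz g h \<in> {w \<in> H2. L w \<in> cfun.span B}"
      by (simp only:) (intro cfun.subspace_neg cfun.subspace_sum cfun.subspace_scale preimage; assumption)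
    then have "L (Toeplitz g h) \<in> cfun.span B" by simp
    moreover have "L (Toeplitz g h) = backward_shift h"
      unfolding L_def Toeplitz_backward_shift[OF g hH h0, symmetric]
      by (rule Toeplitz_left_inverse[OF f1 f2 g geq backward_shift_H2[OF hH]])
    ultimately show ?thesis by simp
  qed
  have "nearly_invariant_defect_le M n (cfun.span B)"
    unfolding nearly_invariant_defect_le_def
  proof (intro conjI ballI impI)
    show "cfun.subspace M" by fact
    show "M \<subseteq> H2" by (auto simp: M_def H2_kernel_def)
    show "cfun.subspace (cfun.span B)" by (rule cfun.subspace_span)
    show "cfun.span B \<subseteq> H2" by (rule cfun.span_minimal[OF B_H2 H2_subspace])
    have fin: "finite B" by (simp add: B_def)
    then show "\<exists>B'. finite B' \<and> cfun.span B \<subseteq> cfun.span B'" by blast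
    have "cfun.dim (cfun.span B) \<le> card B" using fin by (simp add: cfun.dim_le_card')
    also have "\<dots> \<le> n" unfolding B_def using card_image_le[of "{1..n}"] by simp
    finally show "cfun.dim (cfun.span B) \<le> n" .
    fix h assume "h \<in> M" "h 0 = 0"
    then have "0 + backward_shift h \<in> M + cfun.span B"
      by (intro set_plus_intro shift cfun.subspace_0 M)
    then show "backward_shift h \<in> M + cfun.span B" by simp
  qed
  then show ?thesis unfolding M_def B_def L_def .
qed

end
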